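(* Let $(A_1,\dots,A_{p+1})$ be a tuple of diagonalizable matrices in $gl(n,\mathbf{C})$ with $A_1+\dots+A_{p+1}=0$ (resp. $(M_1,\dots,M_{p+1})$ a tuple of diagonalizable matrices in $GL(n,\mathbf{C})$ with $M_1\cdots M_{p+1}=I$) which is block upper-triangular (all matrices of the tuple, with the same sizes of the at least two square diagonal blocks). Suppose that $A_1$ (resp. $M_1$) has $n$ distinct eigenvalues, that the eigenvalues of the tuple are $2$-generic, and that the tuple of conjugacy classes is not in Case A). Then the conjugacy classes of the matrices satisfy the conditions $$(\beta_n)\quad \text{for all } j:\ r_1+\dots+\hat r_j+\dots+r_{p+1}\ge n,\qquad (\alpha_n)\quad d_1+\dots+d_{p+1}\ge 2n^2-2$$ (the hat means that the term is omitted). Moreover, the tuple can be deformed into a tuple of matrices from the same respective conjugacy classes, again with zero sum (resp. with product $I$), and with trivial centralizer.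
   Context: For the $j$-th matrix of the tuple, $d_j$ is the dimension of its conjugacy class and $r_j=\min_{\lambda\in\mathbf{C}}\mathrm{rank}(Y-\lambda I)$ where $Y$ is the matrix. The multiplicity vector (MV) of a diagonalizable matrix is the vector of multiplicities of its eigenvalues. Case A): $n\ge 4$ is even, exactly two of the matrices with indices $j\ge 2$ are non-scalar, and the MV of each of these two equals $(n/2,n/2)$. A tuple has trivial centralizer if only scalar matrices commute with all matrices of the tuple. "Can be deformed into" a tuple with a given property means that there are tuples with this property (from the same conjugacy classes, satisfying the same sum or product condition) arbitrarily close to the given one. Genericity: let $\lambda_{k,j}$ (resp. $\sigma_{k,j}$), $1\le k\le n$, be the eigenvalues of $A_j$ (resp. $M_j$) repeated with multiplicity. A non-genericity relation ($N$-relation) is an equality $\sum_{j=1}^{p+1}\sum_{k\in\Phi_j}\lambda_{k,j}=0$ (resp. $\prod_{j=1}^{p+1}\prod_{k\in\Phi_j}\sigma_{k,j}=1$), where the sets $\Phi_j\subset\{1,\dots,n\}$ all have the same number $N$ of elements, $0<N<n$. Since an $N$-relation yields an $(n-N)$-relation by taking complements, only relations with $N\le n/2$ are considered. The eigenvalues are $k$-generic if the only non-genericity relations (with $N\le n/2$) which they satisfy are with $N\ge k$. *)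

theory Defs
  imports "HOL-Analysis.Analysis" "HOL-Computational_Algebra.Polynomial"
    "HOL-Library.Multiset"
begin

section \<open>Eigenvalues, diagonalizability and conjugacy classes\<close>

definition scalar_matrix :: "complex^'n^'n \<Rightarrow> bool" where
  "scalar_matrix A \<longleftrightarrow> (\<exists>c. A = mat c)"

definition conj_class :: "complex^'n^'n \<Rightarrow> (complex^'n^'n) set" where
  "conj_class A = {P ** A ** matrix_inv P | P. invertible P}"

definition diagonalizable :: "complex^'n^'n \<Rightarrow> bool" where
  "diagonalizable A \<longleftrightarrow> (\<exists>D\<in>conj_class A. \<forall>i j. i \<noteq> j \<longrightarrow> D $ i $ j = 0)"

definition eigenvalues :: "complex^'n^'n \<Rightarrow> complex set" where
  "eigenvalues A = {c. \<exists>v. v \<noteq> 0 \<and> A *v v = c *s v}"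

definition charpoly :: "complex^'n^'n \<Rightarrow> complex poly" where
  "charpoly A = det (mat [:0, 1:] - (\<chi> i j. [:A $ i $ j:]))"

definition eigenvalue_enum :: "complex^'n^'n \<Rightarrow> ('n \<Rightarrow> complex) \<Rightarrow> bool" where
  "eigenvalue_enum A l \<longleftrightarrow> charpoly A = (\<Prod>k\<in>UNIV. [:- l k, 1:])"

definition multiplicity_vector :: "complex^'n^'n \<Rightarrow> nat multiset" where
  "multiplicity_vector A =
     image_mset (\<lambda>c. order c (charpoly A)) (mset_set (eigenvalues A))"

definition min_rank :: "complex^'n^'n \<Rightarrow> nat" where
  "min_rank A = Min (range (\<lambda>c. rank (A - mat c)))"

section \<open>Dimension of a conjugacy class\<close>

text \<open>Differentiability with a complex Jacobian matrix, i.e. with a complex linear derivative.\<close>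

definition holomorphic_map_on ::
    "(complex^'m \<Rightarrow> complex^'m) \<Rightarrow> (complex^'m) set \<Rightarrow> bool" where
  "holomorphic_map_on f U \<longleftrightarrow> (\<forall>x\<in>U. \<exists>J. (f has_derivative (\<lambda>h. J *v h)) (at x))"

text \<open>Embedded complex submanifolds of dimension \<open>d\<close>: around each point a biholomorphic change
  of coordinates of the ambient space turns the set into a \<open>d\<close>-dimensional complex subspace.\<close>

definition complex_submanifold :: "nat \<Rightarrow> (complex^'m) set \<Rightarrow> bool" where
  "complex_submanifold d S \<longleftrightarrow>
     (\<forall>x\<in>S. \<exists>U V f g W.
        open U \<and> open V \<and> x \<in> U \<and>
        holomorphic_map_on f U \<and> holomorphic_map_on g V \<and>
        f ` U = V \<and> g ` V = U \<and> (\<forall>u\<in>U. g (f u) = u) \<and> (\<forall>v\<in>V. f (g v) = v) \<and>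
        vec.subspace W \<and> vec.dim W = d \<and> f ` (U \<inter> S) = V \<inter> W)"

text \<open>The dimension of a nonempty set is the largest dimension of a nonempty complex submanifold
  contained in it. On submanifolds, such as conjugacy classes, this is the usual
  dimension; see \<open>complex_dimension_submanifold\<close> below.\<close>

definition complex_dimension :: "(complex^'m) set \<Rightarrow> nat" where
  "complex_dimension S = Max {d. \<exists>G. G \<noteq> {} \<and> G \<subseteq> S \<and> complex_submanifold d G}"

definition flatten :: "complex^'n^'n \<Rightarrow> complex^('n \<times> 'n)" where
  "flatten A = (\<chi> q. A $ fst q $ snd q)"

definition class_dim :: "complex^'n^'n \<Rightarrow> nat" where
  "class_dim A = complex_dimension (flatten ` conj_class A)"

lemma submanifold_dim_mono:
  fixes S G :: "(complex^'m) set"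
  assumes S: "complex_submanifold d S" and G: "complex_submanifold e G"
    and sub: "G \<subseteq> S" and ne: "G \<noteq> {}"
  shows "e \<le> d"
proof -
  obtain x where xG: "x \<in> G" using ne by auto
  then have xS: "x \<in> S" using sub by auto
  obtain U V f g W where A: "open U" "open V" "x \<in> U" "holomorphic_map_on f U"
      "holomorphic_map_on g V" "f ` U = V" "g ` V = U" "\<forall>u\<in>U. g (f u) = u"
      "\<forall>v\<in>V. f (g v) = v" "vec.subspace W" "vec.dim W = d" "f ` (U \<inter> S) = V \<inter> W"
    using bspec[OF S[unfolded complex_submanifold_def] xS]
    by (elim exE conjE) (rule that; assumption)
  obtain U' V' f' g' W' where B: "open U'" "open V'" "x \<in> U'" "holomorphic_map_on f' U'"
      "holomorphic_map_on g' V'" "f' ` U' = V'" "g' ` V' = U'" "\<forall>u\<in>U'. g' (f' u) = u"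
      "\<forall>v\<in>V'. f' (g' v) = v" "vec.subspace W'" "vec.dim W' = e" "f' ` (U' \<inter> G) = V' \<inter> W'"
    using bspec[OF G[unfolded complex_submanifold_def] xG]
    by (elim exE conjE) (rule that; assumption)
  define y where "y = f' x"
  have y: "y \<in> V'" "y \<in> W'" using B xG by (auto simp: y_def)
  have gy: "g' y = x" using B by (simp add: y_def)
  have fx: "f x \<in> V" using A by auto
  obtain F where F: "(f has_derivative (\<lambda>h. F *v h)) (at x)"
    using bspec[OF A(4)[unfolded holomorphic_map_on_def] A(3)] by blast
  obtain K where K: "(g has_derivative (\<lambda>h. K *v h)) (at (f x))"
    using bspec[OF A(5)[unfolded holomorphic_map_on_def] fx] by blast
  obtain F' where F': "(f' has_derivative (\<lambda>h. F' *v h)) (at x)"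
    using bspec[OF B(4)[unfolded holomorphic_map_on_def] B(3)] by blast
  have Fgy: "(f has_derivative (\<lambda>h. F *v h)) (at (g' y))" using F gy by simp
  obtain K' where K': "(g' has_derivative (\<lambda>h. K' *v h)) (at y)"
    using bspec[OF B(5)[unfolded holomorphic_map_on_def] y(1)] by blast
  have left: "K *v (F *v h) = h" for h
  proof -
    have "((\<lambda>u. g (f u)) has_derivative (\<lambda>h. K *v (F *v h))) (at x)"
      using has_derivative_compose[OF F K] by simp
    moreover have "((\<lambda>u. g (f u)) has_derivative (\<lambda>h. h)) (at x)"
      by (rule has_derivative_transform_within_open[OF has_derivative_ident A(1) A(3)])
        (use A in auto)
    ultimately show ?thesis
      by (rule has_derivative_unique[THEN fun_cong])
  qed
  have left': "F' *v (K' *v h) = h" for h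
  proof -
    have "((\<lambda>u. f' (g' u)) has_derivative (\<lambda>h. F' *v (K' *v h))) (at y)"
      using has_derivative_compose[OF K'] F' gy by simp
    moreover have "((\<lambda>u. f' (g' u)) has_derivative (\<lambda>h. h)) (at y)"
      by (rule has_derivative_transform_within_open[OF has_derivative_ident B(2) y(1)])
        (use B in auto)
    ultimately show ?thesis
      by (rule has_derivative_unique[THEN fun_cong])
  qed
  define J where "J = F ** K'"
  have J: "((\<lambda>u. f (g' u)) has_derivative (\<lambda>h. J *v h)) (at y)"
    using has_derivative_compose[OF K' Fgy] by (simp add: J_def matrix_vector_mul_assoc)
  have injJ: "inj ((*v) J)"
  proof (rule injI)
    fix a b assume "J *v a = J *v b"
    then have "F *v (K' *v a) = F *v (K' *v b)" by (simp add: J_def matrix_vector_mul_assoc)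
    then have "K *v (F *v (K' *v a)) = K *v (F *v (K' *v b))" by simp
    then have "F' *v (K' *v a) = F' *v (K' *v b)" by (simp only: left)
    then show "a = b" by (simp only: left')
  qed
  have WR: "subspace W"
    unfolding subspace_def
  proof (intro conjI ballI allI)
    fix c :: real and w assume w: "w \<in> W"
    have "c *\<^sub>R w = complex_of_real c *s w"
      by (simp add: vec_eq_iff) (simp add: scaleR_conv_of_real)
    then show "c *\<^sub>R w \<in> W" using vec.subspace_scale[OF A(10) w] by simp
  qed (use A(10) in \<open>auto simp: vec.subspace_def\<close>)
  have JW: "J *v w \<in> W" if w: "w \<in> W'" for w
  proof -
    define c where "c = (\<lambda>t::real. y + complex_of_real t *s w)"
    have c_alt: "c t = y + t *\<^sub>R w" for t
      by (simp add: c_def vec_eq_iff) (simp add: scaleR_conv_of_real)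
    have c0: "c 0 = y" by (simp add: c_alt)
    have cd: "(c has_derivative (\<lambda>t. t *\<^sub>R w)) (at 0)"
      unfolding c_alt[abs_def] by (auto intro!: derivative_eq_intros)
    have hd: "((\<lambda>t. f (g' (c t))) has_derivative (\<lambda>t. J *v (t *\<^sub>R w))) (at 0)"
      using has_derivative_compose[OF cd, of "\<lambda>u. f (g' u)" "\<lambda>h. J *v h"] J c0 by simp
    have "J *v (t *\<^sub>R w) = t *\<^sub>R (J *v w)" for t
      using has_derivative_bounded_linear[OF J] by (simp add: bounded_linear_def linear_cmul)
    then have hv: "((\<lambda>t. f (g' (c t))) has_vector_derivative J *v w) (at 0)"
      using hd by (simp add: has_vector_derivative_def)
    have lim: "((\<lambda>t. (f (g' (c t)) - f x) /\<^sub>R t) \<longlongrightarrow> J *v w) (at 0)"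
    proof -
      have "((\<lambda>t. norm (f (g' (c t)) - f x - t *\<^sub>R (J *v w)) / norm t) \<longlongrightarrow> 0) (at 0)"
        using hv c0 gy by (simp add: has_vector_derivative_def has_derivative_at)
      moreover have "eventually (\<lambda>t::real. norm (f (g' (c t)) - f x - t *\<^sub>R (J *v w)) / norm t =
          norm ((f (g' (c t)) - f x) /\<^sub>R t - J *v w)) (at 0)"
      proof (rule eventually_at_filter[THEN iffD2], rule always_eventually, intro allI impI)
        fix t :: real assume "t \<noteq> 0"
        then have "(f (g' (c t)) - f x) /\<^sub>R t - J *v w =
            (f (g' (c t)) - f x - t *\<^sub>R (J *v w)) /\<^sub>R t"
          by (simp add: scaleR_diff_right)
        then show "norm (f (g' (c t)) - f x - t *\<^sub>R (J *v w)) / norm t =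
            norm ((f (g' (c t)) - f x) /\<^sub>R t - J *v w)"
          by (simp only: norm_scaleR) (simp add: divide_inverse mult.commute)
      qed
      ultimately have "((\<lambda>t. norm ((f (g' (c t)) - f x) /\<^sub>R t - J *v w)) \<longlongrightarrow> 0) (at 0)"
        by (rule Lim_transform_eventually)
      then show ?thesis
        by (rule LIM_zero_cancel[OF tendsto_norm_zero_cancel])
    qed
    have cc: "(c \<longlongrightarrow> y) (at 0)"
      using has_derivative_continuous[OF cd] c0 by (simp add: continuous_within)
    have "((\<lambda>u. g' u) \<longlongrightarrow> x) (at y)"
      using has_derivative_continuous[OF K'] gy by (simp add: continuous_within)
    then have gc: "((\<lambda>t. g' (c t)) \<longlongrightarrow> x) (at 0)"
      using isCont_tendsto_compose[OF has_derivative_continuous[OF K'] cc] gy by simp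
    have "eventually (\<lambda>t. c t \<in> V' \<and> g' (c t) \<in> U) (at 0)"
      using topological_tendstoD[OF cc B(2) y(1)] topological_tendstoD[OF gc A(1) A(3)]
      by (rule eventually_conj)
    then have inW: "eventually (\<lambda>t. (f (g' (c t)) - f x) /\<^sub>R t \<in> W) (at 0)"
    proof (rule eventually_mono)
      fix t :: real assume t: "c t \<in> V' \<and> g' (c t) \<in> U"
      have "c t \<in> W'"
        using y w vec.subspace_add[OF B(10)] vec.subspace_scale[OF B(10)] by (simp add: c_def)
      then obtain z where z: "z \<in> U'" "z \<in> G" "c t = f' z" using t B(12) by blast
      then have "g' (c t) \<in> G" using B(8) by simp
      then have "f (g' (c t)) \<in> W" using t sub A(12) by blast
      moreover have "f x \<in> W" using xS A(3,12) by blast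
      ultimately show "(f (g' (c t)) - f x) /\<^sub>R t \<in> W"
        using WR by (simp add: subspace_diff subspace_scale)
    qed
    show ?thesis
      by (rule Lim_in_closed_set[OF closed_subspace[OF WR] inW _ lim]) simp
  qed
  have "vec.dim W' = vec.dim ((*v) J ` W')"
    by (rule vec.dim_image_eq[OF matrix_vector_mul_linear_gen inj_on_subset[OF injJ subset_UNIV],
          symmetric])
  also have "\<dots> \<le> vec.dim W" using JW by (intro vec.dim_subset) auto
  finally show ?thesis using A B by simp
qed

lemma complex_dimension_submanifold:
  assumes "complex_submanifold d S" "S \<noteq> {}"
  shows "complex_dimension S = d"
  unfolding complex_dimension_def
proof (rule Max_eqI)
  show "finite {d. \<exists>G. G \<noteq> {} \<and> G \<subseteq> S \<and> complex_submanifold d G}"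
    by (rule finite_subset[of _ "{..d}"]) (use assms submanifold_dim_mono in blast)+
qed (use assms submanifold_dim_mono in blast)+

section \<open>Tuples of matrices\<close>

text \<open>A tuple \<open>X\<^sub>1, \<dots>, X\<^bsub>p+1\<^esub>\<close> is a function on \<open>nat\<close> restricted to the index set \<open>{1..p+1}\<close>.\<close>

definition zero_sum :: "nat \<Rightarrow> (nat \<Rightarrow> complex^'n^'n) \<Rightarrow> bool" where
  "zero_sum p X \<longleftrightarrow> (\<Sum>j\<in>{1..p+1}. X j) = 0"

definition unit_product :: "nat \<Rightarrow> (nat \<Rightarrow> complex^'n^'n) \<Rightarrow> bool" where
  "unit_product p X \<longleftrightarrow> foldr (\<lambda>j B. X j ** B) [1..<p+2] (mat 1) = mat 1"

text \<open>The map \<open>b\<close> assigns to each row (column) index the number of the diagonal block it belongs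
  to; by monotonicity the blocks are consecutive intervals of indices.\<close>

definition block_upper_triangular ::
    "nat \<Rightarrow> (nat \<Rightarrow> complex^('n::{finite,linorder})^('n::{finite,linorder})) \<Rightarrow> bool" where
  "block_upper_triangular p X \<longleftrightarrow>
     (\<exists>b :: 'n \<Rightarrow> nat. mono b \<and> (\<exists>i k. b i \<noteq> b k) \<and>
        (\<forall>j\<in>{1..p+1}. \<forall>i k. b k < b i \<longrightarrow> X j $ i $ k = 0))"

definition trivial_centralizer :: "nat \<Rightarrow> (nat \<Rightarrow> complex^'n^'n) \<Rightarrow> bool" where
  "trivial_centralizer p X \<longleftrightarrow>
     (\<forall>B. (\<forall>j\<in>{1..p+1}. B ** X j = X j ** B) \<longrightarrow> scalar_matrix B)"

definition case_A :: "nat \<Rightarrow> (nat \<Rightarrow> complex^'n^'n) \<Rightarrow> bool" where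
  "case_A p X \<longleftrightarrow> CARD('n) \<ge> 4 \<and> even CARD('n) \<and>
     card {j\<in>{2..p+1}. \<not> scalar_matrix (X j)} = 2 \<and>
     (\<forall>j\<in>{2..p+1}. \<not> scalar_matrix (X j) \<longrightarrow>
        multiplicity_vector (X j) = {#CARD('n) div 2, CARD('n) div 2#})"

definition additive_relation ::
    "nat \<Rightarrow> (nat \<Rightarrow> 'n::finite \<Rightarrow> complex) \<Rightarrow> nat \<Rightarrow> bool" where
  "additive_relation p l N \<longleftrightarrow> 0 < N \<and> N < CARD('n) \<and>
     (\<exists>\<Phi>. (\<forall>j\<in>{1..p+1}. card (\<Phi> j) = N) \<and>
          (\<Sum>j\<in>{1..p+1}. \<Sum>k\<in>\<Phi> j. l j k) = 0)"

definition multiplicative_relation ::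
    "nat \<Rightarrow> (nat \<Rightarrow> 'n::finite \<Rightarrow> complex) \<Rightarrow> nat \<Rightarrow> bool" where
  "multiplicative_relation p l N \<longleftrightarrow> 0 < N \<and> N < CARD('n) \<and>
     (\<exists>\<Phi>. (\<forall>j\<in>{1..p+1}. card (\<Phi> j) = N) \<and>
          (\<Prod>j\<in>{1..p+1}. \<Prod>k\<in>\<Phi> j. l j k) = 1)"

definition additively_generic ::
    "nat \<Rightarrow> nat \<Rightarrow> (nat \<Rightarrow> 'n::finite \<Rightarrow> complex) \<Rightarrow> bool" where
  "additively_generic m p l \<longleftrightarrow>
     (\<forall>N. additive_relation p l N \<and> 2 * N \<le> CARD('n) \<longrightarrow> m \<le> N)"

definition multiplicatively_generic ::
    "nat \<Rightarrow> nat \<Rightarrow> (nat \<Rightarrow> 'n::finite \<Rightarrow> complex) \<Rightarrow> bool" where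
  "multiplicatively_generic m p l \<longleftrightarrow>
     (\<forall>N. multiplicative_relation p l N \<and> 2 * N \<le> CARD('n) \<longrightarrow> m \<le> N)"

definition cond_beta :: "nat \<Rightarrow> (nat \<Rightarrow> complex^'n^'n) \<Rightarrow> bool" where
  "cond_beta p X \<longleftrightarrow>
     (\<forall>j\<in>{1..p+1}. (\<Sum>i\<in>{1..p+1} - {j}. min_rank (X i)) \<ge> CARD('n))"

definition cond_alpha :: "nat \<Rightarrow> (nat \<Rightarrow> complex^'n^'n) \<Rightarrow> bool" where
  "cond_alpha p X \<longleftrightarrow> (\<Sum>j\<in>{1..p+1}. class_dim (X j)) \<ge> 2 * CARD('n)\<^sup>2 - 2"

definition deformable ::
    "(nat \<Rightarrow> (nat \<Rightarrow> complex^'n^'n) \<Rightarrow> bool) \<Rightarrow> (nat \<Rightarrow> (nat \<Rightarrow> complex^'n^'n) \<Rightarrow> bool) \<Rightarrow>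
     nat \<Rightarrow> (nat \<Rightarrow> complex^'n^'n) \<Rightarrow> bool" where
  "deformable R Q p X \<longleftrightarrow>
     (\<forall>\<epsilon>>0. \<exists>Y. (\<forall>j\<in>{1..p+1}. Y j \<in> conj_class (X j) \<and> dist (Y j) (X j) < \<epsilon>) \<and>
                 R p Y \<and> Q p Y)"

end

theory Submission
  imports Defs
begin

text \<open>
  All statements rest on one consequence of genericity. There are at least two diagonal blocks, so
  \<open>n \<ge> 2\<close>, and a 2-generic tuple satisfies no relation with one eigenvalue per matrix. By the sum or
  product condition, a common eigenvector of all matrices but one is also an eigenvector of the
  remaining matrix, and its eigenvalues form such a relation. Hence all matrices but one never have a
  common eigenvector, for the given tuple and for every other solution in the same conjugacy classes.

  Condition \<open>\<beta>\<^sub>n\<close> follows at once: if the ranks of \<open>X\<^sub>i - \<mu>\<^sub>i\<close> for \<open>i \<noteq> j\<close> had sum less than \<open>n\<close>,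
  the kernels would have a nonzero common vector. The lemma \<open>no_common_eigenvector_count\<close> proves this
  in a form localized to a diagonal block.

  For the deformation, the tuple is conjugated so that \<open>X\<^sub>1\<close> is diagonal. A matrix commuting with
  the tuple is then diagonal, and a non-scalar one yields a set \<open>C\<close> of indices such that all \<open>X\<^sub>j\<close> are
  block diagonal with respect to \<open>C\<close> and its complement. The tuple is perturbed to \<open>X\<^sub>j + t T\<^sub>j\<close>
  for \<open>j \<ge> 2\<close>, with \<open>T\<^sub>j\<close> supported in the rows \<open>C\<close> and columns \<open>- C\<close>. Two such corner matrices have
  product zero. Therefore the class of \<open>X\<^sub>j\<close> is preserved for \<open>T\<^sub>j\<close> in a linear space whose dimension
  is the number of pairs \<open>(a, b) \<in> C \<times> - C\<close> of indices of different eigenvalues of \<open>X\<^sub>j\<close>, and the sum or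
  product condition becomes a system of \<open>|C| |- C|\<close> linear equations. The localized rank count,
  applied for each \<open>b\<close> with \<open>\<mu>\<^sub>j\<close> the eigenvalue of index \<open>b\<close>, shows that there are at least
  \<open>|C| |- C|\<close> unknowns. If there are more, a nonzero solution exists (\<open>extension_exists\<close>); it fills
  positions that were zero in all matrices, and iterating leads to a trivial centralizer
  (\<open>deform_diagonal\<close>). If the numbers agree, the eigenvalues of each block have the largest
  multiplicity in the other block, and this forces exactly two non-scalar matrices with \<open>j \<ge> 2\<close>, each
  having two eigenvalues of multiplicity \<open>n / 2\<close> (\<open>tight_count_halves\<close>): this is Case A.

  For condition \<open>\<alpha>\<^sub>n\<close>, the dimension of the class of \<open>X\<^sub>j\<close> is bounded below by the number of pairs of
  indices with different eigenvalues, by an explicit chart (\<open>class_dim_ge\<close>). For \<open>X\<^sub>1\<close> this number is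
  \<open>n\<^sup>2 - n\<close>. For the other matrices \<open>\<beta>\<^sub>n\<close> gives a total of at least \<open>n\<^sup>2\<close>, and the missing \<open>n - 2\<close> come
  from an estimate of multiplicities that can fail only in Case A (\<open>card_pairs_lower_bound\<close>).
\<close>

section \<open>Underdetermined linear systems\<close>

text \<open>Gaussian elimination, one equation at a time. Unknowns and equations are indexed by arbitrary
  finite sets, because below they are indexed by dependent sums over the matrices of a tuple.\<close>

lemma homogeneous_system_nontrivial:
  fixes a :: "'i \<Rightarrow> 'r \<Rightarrow> 'f::field"
  assumes "finite R" "finite I" "card R < card I"
  shows "\<exists>c. (\<exists>i\<in>I. c i \<noteq> 0) \<and> (\<forall>r\<in>R. (\<Sum>i\<in>I. c i * a i r) = 0)"
  using assms
proof (induction R arbitrary: I a rule: finite_induct)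
  case empty
  then obtain i where "i \<in> I" by fastforce
  then show ?case by (intro exI[of _ "\<lambda>_. 1"]) auto
next
  case (insert r R)
  show ?case
  proof (cases "\<forall>i\<in>I. a i r = 0")
    case True
    have "card R < card I" using insert by simp
    with insert.IH[OF insert.prems(1) this, of a] True show ?thesis by auto
  next
    case False
    then obtain k where k: "k \<in> I" "a k r \<noteq> 0" by auto
    \<comment> \<open>The \<open>r\<close>-th equation is solved for the \<open>k\<close>-th unknown and substituted into the others.\<close>
    define I' where "I' = I - {k}"
    define a' where "a' = (\<lambda>i s. a i s - a i r / a k r * a k s)"
    have "finite I'" "card R < card I'"
      using insert k by (auto simp: I'_def)
    from insert.IH[OF this, of a'] obtain c where
      c: "\<exists>i\<in>I'. c i \<noteq> 0" "\<forall>s\<in>R. (\<Sum>i\<in>I'. c i * a' i s) = 0" by blast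
    define ck where "ck = - (\<Sum>i\<in>I'. c i * (a i r / a k r))"
    define d where "d = c(k := ck)"
    have sums: "(\<Sum>i\<in>I. d i * a i s) = (\<Sum>i\<in>I'. c i * a' i s)" for s
    proof -
      have "(\<Sum>i\<in>I. d i * a i s) = d k * a k s + (\<Sum>i\<in>I'. d i * a i s)"
        unfolding I'_def by (rule sum.remove) (use insert.prems k in auto)
      also have "(\<Sum>i\<in>I'. d i * a i s) = (\<Sum>i\<in>I'. c i * a i s)"
        by (rule sum.cong) (auto simp: d_def I'_def)
      also have "d k * a k s + (\<Sum>i\<in>I'. c i * a i s) = (\<Sum>i\<in>I'. c i * a' i s)"
        by (simp add: d_def ck_def a'_def sum_distrib_right right_diff_distrib sum_subtractf mult.assoc)
      finally show ?thesis .
    qed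
    have "a' i r = 0" for i using k by (simp add: a'_def)
    then have "\<forall>s\<in>insert r R. (\<Sum>i\<in>I. d i * a i s) = 0"
      using c(2) by (auto simp: sums)
    moreover have "\<exists>i\<in>I. d i \<noteq> 0" using c(1) by (auto simp: d_def I'_def)
    ultimately show ?thesis by blast
  qed
qed

section \<open>Matrix algebra\<close>

lemma matrix_mul_nth: "(A ** B) $ i $ k = (\<Sum>m\<in>UNIV. A $ i $ m * B $ m $ k)"
  by (simp add: matrix_matrix_mult_def)

lemma matrix_mul_diff_right: "A ** (B - C) = A ** B - A ** (C :: complex^'n^'n)"
  for A :: "complex^'n^'n"
  by (simp add: vec_eq_iff matrix_mul_nth right_diff_distrib sum_subtractf)

lemma matrix_mul_diff_left: "(B - C) ** A = B ** A - (C :: complex^'n^'n) ** A"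
  for A :: "complex^'n^'n"
  by (simp add: vec_eq_iff matrix_mul_nth left_diff_distrib sum_subtractf)

lemma matrix_mul_add_left: "(B + C) ** A = B ** A + (C :: complex^'n^'n) ** A"
  for A :: "complex^'n^'n"
  by (simp add: vec_eq_iff matrix_mul_nth distrib_right sum.distrib)

lemma matrix_mul_minus_right: "A ** (- B) = - (A ** B)" for A B :: "complex^'n^'n"
  by (simp add: vec_eq_iff matrix_mul_nth sum_negf)

lemma matrix_mul_minus_left: "(- A) ** B = - (A ** B)" for A B :: "complex^'n^'n"
  by (simp add: vec_eq_iff matrix_mul_nth sum_negf)

lemma matrix_mul_sum_right: "A ** (\<Sum>j\<in>K. B j) = (\<Sum>j\<in>K. A ** B j)"
  for A :: "complex^'n^'n" and B :: "'k \<Rightarrow> complex^'n^'n"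
  by (induction K rule: infinite_finite_induct) (auto simp: matrix_add_ldistrib)

lemma matrix_mul_sum_left: "(\<Sum>j\<in>K. B j) ** A = (\<Sum>j\<in>K. B j ** A)"
  for A :: "complex^'n^'n" and B :: "'k \<Rightarrow> complex^'n^'n"
  by (induction K rule: infinite_finite_induct) (auto simp: matrix_mul_add_left)

lemmas matrix_ring_simps = matrix_mul_add_left matrix_add_ldistrib matrix_mul_diff_left
  matrix_mul_diff_right matrix_mul_minus_left matrix_mul_minus_right

lemma matrix_inv_mult:
  assumes "invertible (A :: complex^'n^'n)"
  shows "A ** matrix_inv A = mat 1" "matrix_inv A ** A = mat 1"
proof -
  have "A ** matrix_inv A = mat 1 \<and> matrix_inv A ** A = mat 1"
    unfolding matrix_inv_def using assms[unfolded invertible_def] by (rule someI_ex)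
  then show "A ** matrix_inv A = mat 1" "matrix_inv A ** A = mat 1" by auto
qed

lemma matrix_inv_cancel:
  assumes "invertible (A :: complex^'n^'n)"
  shows "A ** (matrix_inv A ** B) = B" "matrix_inv A ** (A ** B) = B"
    "B ** A ** matrix_inv A = B" "B ** matrix_inv A ** A = B"
  using matrix_inv_mult[OF assms]
  by (simp_all add: matrix_mul_assoc) (simp_all flip: matrix_mul_assoc)

lemma invertible_matrix_inv: "invertible A \<Longrightarrow> invertible (matrix_inv A)"
  for A :: "complex^'n^'n"
  unfolding invertible_def[of "matrix_inv A"] using matrix_inv_mult by blast

lemma matrix_inv_unique:
  assumes "A ** B = mat 1" shows "matrix_inv A = (B :: complex^'n^'n)"
proof -
  have "B ** A = mat 1" using assms by (simp add: matrix_left_right_inverse)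
  then have inv: "invertible A" using assms by (auto simp: invertible_def)
  have "matrix_inv A = matrix_inv A ** (A ** B)" using assms by simp
  then show ?thesis by (simp add: matrix_inv_cancel inv)
qed

section \<open>Conjugacy classes\<close>

lemma conj_class_refl: "A \<in> conj_class A"
  unfolding conj_class_def mem_Collect_eq
  by (rule exI[of _ "mat 1"]) (simp add: matrix_inv_unique[of "mat 1" "mat 1"] invertible_def exI[of _ "mat 1"])

lemma conj_classI: "invertible P \<Longrightarrow> B ** P = P ** A \<Longrightarrow> B \<in> conj_class A"
  unfolding conj_class_def mem_Collect_eq
  by (rule exI[of _ P]) (metis matrix_inv_cancel(3))

lemma conj_classE:
  assumes "B \<in> conj_class A"
  obtains P where "invertible P" "B ** P = P ** A"
proof -
  from assms obtain P where P: "invertible P" "B = P ** A ** matrix_inv P"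
    by (auto simp: conj_class_def)
  then show ?thesis by (intro that[of P]) (auto simp: matrix_inv_cancel)
qed

lemma conj_class_trans: "B \<in> conj_class A \<Longrightarrow> C \<in> conj_class B \<Longrightarrow> C \<in> conj_class A"
proof (elim conj_classE)
  fix P Q assume "invertible P" "B ** P = P ** A" "invertible Q" "C ** Q = Q ** B"
  then show ?thesis
    by (intro conj_classI[of "Q ** P"]) (metis invertible_mult, metis matrix_mul_assoc)
qed

lemma conj_class_sym: "B \<in> conj_class A \<Longrightarrow> A \<in> conj_class B"
proof (elim conj_classE)
  fix P assume P: "invertible P" "B ** P = P ** A"
  then show ?thesis
    by (intro conj_classI[of "matrix_inv P"])
      (auto simp: invertible_matrix_inv, metis matrix_inv_cancel(2,3) matrix_mul_assoc)
qed

lemma conj_class_eq: "B \<in> conj_class A \<Longrightarrow> conj_class B = conj_class A"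
  using conj_class_trans conj_class_sym by blast

section \<open>Diagonal matrices and eigenbases\<close>

definition diag :: "('n \<Rightarrow> complex) \<Rightarrow> complex^'n^'n" where
  "diag d = (\<chi> i k. if i = k then d i else 0)"

lemma diag_nth: "diag d $ i $ k = (if i = k then d i else 0)"
  by (simp add: diag_def)

lemma diag_mul_left: "(diag d ** A) $ i $ k = d i * A $ i $ k"
  by (simp add: matrix_mul_nth diag_nth if_distrib[of "\<lambda>x. x * _"] sum.delta cong: if_cong)

lemma diag_mul_right: "(A ** diag d) $ i $ k = A $ i $ k * d k"
  by (simp add: matrix_mul_nth diag_nth if_distrib[of "\<lambda>x. _ * x"] sum.delta' cong: if_cong)

lemma diag_mul_vec: "(diag d *v v) $ i = d i * v $ i"
  by (simp add: matrix_vector_mult_def diag_nth if_distrib[of "\<lambda>x. x * _"] sum.delta cong: if_cong)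

lemma mat_eq_diag: "mat c = diag (\<lambda>_. c)"
  by (simp add: vec_eq_iff diag_nth mat_def)

text \<open>The columns of \<open>Q\<close> form a basis of eigenvectors, \<open>d k\<close> being the eigenvalue of the \<open>k\<close>-th
  column. The function \<open>d\<close> lists the eigenvalues with multiplicity.\<close>

definition eigenbasis :: "complex^'n^'n \<Rightarrow> complex^'n^'n \<Rightarrow> ('n \<Rightarrow> complex) \<Rightarrow> bool" where
  "eigenbasis A Q d \<longleftrightarrow> invertible Q \<and> A ** Q = Q ** diag d"

lemma diagonalizable_iff_eigenbasis:
  fixes A :: "complex^'n^'n"
  shows "diagonalizable A \<longleftrightarrow> (\<exists>Q d. eigenbasis A Q d)"
proof
  assume "diagonalizable A"
  then obtain D where D: "D \<in> conj_class A" "\<And>i j. i \<noteq> j \<Longrightarrow> D $ i $ j = 0"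
    by (auto simp: diagonalizable_def)
  have "D = diag (\<lambda>i. D $ i $ i)" using D(2) by (auto simp: vec_eq_iff diag_nth)
  then show "\<exists>Q d. eigenbasis A Q d"
    using conj_class_sym[OF D(1)] by (metis conj_classE eigenbasis_def)
next
  assume "\<exists>Q d. eigenbasis A Q d"
  then obtain Q :: "complex^'n^'n" and d where "invertible Q" "A ** Q = Q ** diag d"
    unfolding eigenbasis_def by blast
  then have "diag d \<in> conj_class A" by (metis conj_class_sym conj_classI)
  then show "diagonalizable A" unfolding diagonalizable_def
    by (intro bexI[of _ "diag d"]) (auto simp: diag_nth)
qed

lemma eigenbasis_conj: "eigenbasis A Q d \<Longrightarrow> B \<in> conj_class A \<Longrightarrow> \<exists>Q'. eigenbasis B Q' d"
proof (elim conj_classE)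
  fix P assume "eigenbasis A Q d" "invertible P" "B ** P = P ** A"
  then have "eigenbasis B (P ** Q) d"
    unfolding eigenbasis_def by (metis invertible_mult matrix_mul_assoc)
  then show ?thesis by blast
qed

lemma diagonalizable_conj: "diagonalizable A \<Longrightarrow> B \<in> conj_class A \<Longrightarrow> diagonalizable B"
  using eigenbasis_conj by (metis diagonalizable_iff_eigenbasis)

lemma vec_coords:
  assumes "invertible (Q :: complex^'n^'n)"
  shows "Q *v (matrix_inv Q *v v) = v" "matrix_inv Q *v (Q *v v) = v"
  using matrix_inv_mult[OF assms] by (simp_all add: matrix_vector_mul_assoc)

lemma eigenbasis_eigenvalues:
  assumes "eigenbasis A Q d"
  shows "eigenvalues A = range d"
proof (intro set_eqI iffI)
  fix c assume "c \<in> eigenvalues A"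
  then obtain v where v: "v \<noteq> 0" "A *v v = c *s v" by (auto simp: eigenvalues_def)
  define w where "w = matrix_inv Q *v v"
  have Q: "invertible Q" "A ** Q = Q ** diag d" using assms by (auto simp: eigenbasis_def)
  have vw: "v = Q *v w" by (simp add: w_def vec_coords Q)
  have "Q *v (diag d *v w) = Q *v (c *s w)"
    using v(2) Q(2) vw by (metis matrix_vector_mul_assoc vector_scalar_commute)
  then have "diag d *v w = c *s w" by (metis vec_coords(2) Q(1))
  then have "d i * w $ i = c * w $ i" for i by (metis diag_mul_vec vector_smult_component)
  moreover have "w \<noteq> 0" using v vw by auto
  ultimately show "c \<in> range d" by (metis mult_cancel_right rangeI vec_eq_iff zero_index)
next
  fix c assume "c \<in> range d"
  then obtain i where i: "c = d i" by auto
  have Q: "invertible Q" "A ** Q = Q ** diag d" using assms by (auto simp: eigenbasis_def)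
  have "diag d *v axis i 1 = c *s axis i 1"
    by (simp add: vec_eq_iff diag_mul_vec axis_def i)
  then have "A *v (Q *v axis i 1) = c *s (Q *v axis i 1)"
    by (metis matrix_vector_mul_assoc vector_scalar_commute Q(2))
  moreover have "Q *v axis i 1 \<noteq> 0"
    by (metis Q(1) vec_coords(2) matrix_vector_mult_0_right axis_eq_0_iff zero_neq_one)
  ultimately show "c \<in> eigenvalues A" by (auto simp: eigenvalues_def)
qed

lemma eigenvalues_conj: "B \<in> conj_class A \<Longrightarrow> eigenvalues B = eigenvalues A"
proof -
  have *: "eigenvalues A \<subseteq> eigenvalues B" if "B \<in> conj_class A" for A B :: "complex^'n^'n"
    using that
  proof (elim conj_classE, intro subsetI)
    fix P c assume P: "invertible P" "B ** P = P ** A" "c \<in> eigenvalues A"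
    then obtain v where v: "v \<noteq> 0" "A *v v = c *s v" by (auto simp: eigenvalues_def)
    have "B *v (P *v v) = c *s (P *v v)"
      using P v by (metis matrix_vector_mul_assoc vector_scalar_commute)
    moreover have "P *v v \<noteq> 0" using v P by (metis vec_coords(2) matrix_vector_mult_0_right)
    ultimately show "c \<in> eigenvalues B" by (auto simp: eigenvalues_def)
  qed
  assume "B \<in> conj_class A"
  then show ?thesis using * conj_class_sym by blast
qed

lemma scalar_matrix_conj: "B \<in> conj_class A \<Longrightarrow> scalar_matrix B \<longleftrightarrow> scalar_matrix A"
proof -
  have *: "scalar_matrix B" if "B \<in> conj_class A" "scalar_matrix A" for A B :: "complex^'n^'n"
    using that
  proof (elim conj_classE)
    fix P assume P: "invertible P" "B ** P = P ** A" "scalar_matrix A"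
    then obtain c where A: "A = mat c" by (auto simp: scalar_matrix_def)
    have "P ** A = mat c ** P"
      unfolding A by (simp add: vec_eq_iff mat_eq_diag[of c] diag_mul_left diag_mul_right mult.commute)
    then have "B = mat c" using P by (metis matrix_inv_cancel(3))
    then show ?thesis by (auto simp: scalar_matrix_def)
  qed
  assume "B \<in> conj_class A"
  then show ?thesis using * conj_class_sym by blast
qed

lemma charpoly_nth:
  fixes A :: "complex^'n^'n"
  shows "(mat [:0, 1:] - (\<chi> i j. [:A $ i $ j:])) $ i $ k =
    (if i = k then [:- A $ i $ i, 1:] else [:- A $ i $ k:])"
  by (auto simp: mat_def)

text \<open>Entrywise embedding of complex matrices into matrices over polynomials is multiplicative, so the
  determinant of the conjugating matrix cancels.\<close>

lemma charpoly_conj: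
  assumes "B \<in> conj_class A" shows "charpoly B = charpoly A"
proof -
  obtain P where P: "invertible P" "B ** P = P ** A" using assms by (rule conj_classE)
  define h :: "complex^'a^'a \<Rightarrow> complex poly^'a^'a" where "h = (\<lambda>A. \<chi> i j. [:A $ i $ j:])"
  have h_sum: "[:sum f S:] = (\<Sum>m\<in>S. [:f m:])" for S :: "'a set" and f :: "'a \<Rightarrow> complex"
    by (rule poly_eqI) (simp add: coeff_sum coeff_pCons split: nat.split)
  have hm: "h (A ** B) = h A ** h B" for A B
    by (simp add: h_def vec_eq_iff matrix_matrix_mult_def h_sum mult.commute)
  have mm: "mat [:0,1:] ** M = M ** mat [:0,1:]" for M :: "complex poly^'a^'a"
    by (simp add: vec_eq_iff mat_def matrix_matrix_mult_def if_distrib[of "\<lambda>x. x * _"]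
        if_distrib[of "\<lambda>x. _ * x"] sum.delta sum.delta' cong: if_cong)
  have sub: "(M - N) ** L = M ** L - N ** L" "L ** (M - N) = L ** M - L ** N"
    for L M N :: "complex poly^'a^'a"
    by (simp_all add: vec_eq_iff matrix_matrix_mult_def left_diff_distrib right_diff_distrib sum_subtractf)
  have "h P ** h (matrix_inv P) = mat 1"
    using matrix_inv_mult(1)[OF P(1)] by (simp flip: hm) (simp add: h_def mat_def vec_eq_iff one_pCons)
  then have "det (h P) * det (h (matrix_inv P)) = 1" by (metis det_mul det_I)
  then have nz: "det (h P) \<noteq> 0" by auto
  have "(mat [:0,1:] - h B) ** h P = h P ** (mat [:0,1:] - h A)"
    by (simp add: sub mm flip: hm) (simp add: P)
  then have "det (mat [:0,1:] - h B) * det (h P) = det (h P) * det (mat [:0,1:] - h A)"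
    by (metis det_mul)
  then show ?thesis using nz by (simp add: charpoly_def h_def)
qed

lemma eigenbasis_charpoly:
  assumes "eigenbasis A Q d" shows "charpoly A = (\<Prod>k\<in>UNIV. [:- d k, 1:])"
proof -
  have "A \<in> conj_class (diag d)" using assms by (auto simp: eigenbasis_def intro: conj_classI)
  then have "charpoly A = charpoly (diag d)" by (rule charpoly_conj)
  also have "\<dots> = (\<Prod>k\<in>UNIV. [:- d k, 1:])"
  proof -
    have nth: "(mat [:0, 1:] - (\<chi> i j. [:diag d $ i $ j:])) $ i $ k =
        (if i = k then [:- d i, 1:] else 0)" for i k
      by (subst charpoly_nth) (auto simp: diag_nth)
    have "charpoly (diag d) = (\<Prod>i\<in>UNIV. (mat [:0, 1:] - (\<chi> i j. [:diag d $ i $ j:])) $ i $ i)"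
      unfolding charpoly_def by (rule det_diagonal) (simp only: nth if_False)
    then show ?thesis by (simp only: nth if_True refl)
  qed
  finally show ?thesis .
qed

lemma order_prod_linear:
  fixes d :: "'k \<Rightarrow> complex"
  assumes "finite K"
  shows "order c (\<Prod>k\<in>K. [:- d k, 1:]) = card {k\<in>K. d k = c}"
  using assms
proof (induction K rule: finite_induct)
  case (insert x K)
  have nz: "[:- d x, 1:] * (\<Prod>k\<in>K. [:- d k, 1:]) \<noteq> 0"
    unfolding mult_eq_0_iff prod_zero_iff[OF insert.hyps(1)] by simp
  have o: "order c [:- d x, 1:] = (if d x = c then 1 else 0)"
    using order_power_n_n[of c 1] by (auto intro: order_0I)
  have "{k \<in> insert x K. d k = c} = (if d x = c then insert x else id) {k\<in>K. d k = c}" by auto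
  then show ?case using insert by (auto simp: order_mult[OF nz] o simp del: mult_pCons_left)
qed auto

lemma eigenbasis_order:
  "eigenbasis A Q d \<Longrightarrow> order c (charpoly A) = card {k. d k = c}"
  using order_prod_linear[of UNIV c d] by (simp add: eigenbasis_charpoly)

text \<open>Both enumerations give linear factorizations of the same characteristic polynomial.\<close>

lemma eigenvalue_in_enum:
  assumes "eigenvalue_enum A l" "eigenbasis A Q d" "c \<in> eigenvalues A"
  shows "\<exists>k. c = l k"
proof -
  obtain i where "c = d i" using assms eigenbasis_eigenvalues by blast
  then have "poly (\<Prod>k\<in>UNIV. [:- d k, 1:]) c = 0"
    by (auto simp: poly_prod intro: prod_zero)
  then have "poly (\<Prod>k\<in>UNIV. [:- l k, 1:]) c = 0"
    using assms by (simp add: eigenvalue_enum_def eigenbasis_charpoly)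
  then show ?thesis by (auto simp: poly_prod)
qed

lemma eigenbasis_scalar_iff:
  assumes "eigenbasis A Q d"
  shows "scalar_matrix A \<longleftrightarrow> (\<exists>c. \<forall>k. d k = c)"
proof -
  have "A \<in> conj_class (diag d)" using assms by (auto simp: eigenbasis_def intro: conj_classI)
  then have "scalar_matrix A \<longleftrightarrow> scalar_matrix (diag d)" by (rule scalar_matrix_conj)
  also have "\<dots> \<longleftrightarrow> (\<exists>c. \<forall>k. d k = c)"
    by (auto simp: scalar_matrix_def vec_eq_iff mat_def diag_nth)
  finally show ?thesis .
qed

section \<open>Block diagonal matrices\<close>

text \<open>The coordinate projection onto the span of the basis vectors with index in \<open>C\<close>. Commuting with
  it is block diagonality with respect to \<open>C\<close> and its complement, which makes the closure
  properties of block diagonal matrices purely algebraic.\<close>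

definition proj :: "'n set \<Rightarrow> complex^'n^'n" where
  "proj C = diag (\<lambda>i. if i \<in> C then 1 else 0)"

definition block_diag :: "'n set \<Rightarrow> complex^'n^'n \<Rightarrow> bool" where
  "block_diag C A \<longleftrightarrow> A ** proj C = proj C ** A"

text \<open>Nonzero entries only in rows from \<open>C\<close> and columns from the complement. Such matrices form a
  bimodule over the block diagonal ones, and the product of any two of them vanishes.\<close>

definition corner :: "'n set \<Rightarrow> complex^'n^'n \<Rightarrow> bool" where
  "corner C T \<longleftrightarrow> proj C ** T = T \<and> T ** proj C = 0"

lemma block_diag_nth:
  "block_diag C A \<longleftrightarrow> (\<forall>i k. A $ i $ k \<noteq> 0 \<longrightarrow> (i \<in> C \<longleftrightarrow> k \<in> C))"
  by (auto simp: block_diag_def proj_def vec_eq_iff diag_mul_left diag_mul_right split: if_splits)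

lemma corner_nth: "corner C T \<longleftrightarrow> (\<forall>i k. T $ i $ k \<noteq> 0 \<longrightarrow> i \<in> C \<and> k \<notin> C)"
  by (auto simp: corner_def proj_def vec_eq_iff diag_mul_left diag_mul_right split: if_splits)

lemma block_diag_mat: "block_diag C (mat c)"
  by (auto simp: block_diag_nth mat_def)

lemma block_diag_mult: "block_diag C A \<Longrightarrow> block_diag C B \<Longrightarrow> block_diag C (A ** B)"
  unfolding block_diag_def by (metis matrix_mul_assoc)

lemma block_diag_inv:
  assumes "block_diag C A" "invertible A" shows "block_diag C (matrix_inv A)"
  using assms unfolding block_diag_def
  by (metis matrix_inv_cancel(2,3) matrix_mul_assoc)

lemma corner_mult_left: "block_diag C A \<Longrightarrow> corner C T \<Longrightarrow> corner C (A ** T)"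
  unfolding block_diag_def corner_def by (metis matrix_mul_assoc times0_right)

lemma corner_mult_right: "block_diag C A \<Longrightarrow> corner C T \<Longrightarrow> corner C (T ** A)"
  unfolding block_diag_def corner_def by (metis matrix_mul_assoc times0_left)

lemma corner_mult_zero: "corner C S \<Longrightarrow> corner C T \<Longrightarrow> S ** T = 0"
  unfolding corner_def by (metis matrix_mul_assoc times0_left)

text \<open>The projections of the eigenvectors to the two coordinate subspaces are again eigenvectors or
  zero, and they span. A basis chosen among them lies in the union of the two subspaces, and for
  dimension reasons it consists of bases of both; its elements are distributed over the columns
  so that \<open>Q\<close> is block diagonal.\<close>

lemma adapted_eigenbasis:
  fixes A :: "complex^'n^'n"
  assumes "diagonalizable A" "block_diag C A"
  shows "\<exists>Q d. eigenbasis A Q d \<and> block_diag C Q"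
proof -
  obtain Q0 :: "complex^'n^'n" and d0 where Q0: "invertible Q0" "A ** Q0 = Q0 ** diag d0"
    using assms(1) unfolding diagonalizable_iff_eigenbasis eigenbasis_def by blast
  define v where "v k = column k Q0" for k
  have Av: "A *v v k = d0 k *s v k" for k
  proof -
    have "(A *v v k) $ i = (A ** Q0) $ i $ k" for i
      by (simp add: v_def column_def matrix_vector_mult_def matrix_mul_nth)
    then show ?thesis
      by (simp add: vec_eq_iff Q0 diag_mul_right v_def column_def mult.commute)
  qed
  define B1 where "B1 = range (\<lambda>k. proj C *v v k)"
  define B2 where "B2 = range (\<lambda>k. v k - proj C *v v k)"
  define VC where "VC D = {x::complex^'n. \<forall>i. i \<notin> D \<longrightarrow> x $ i = 0}" for D
  have B1V: "B1 \<subseteq> VC C" and B2V: "B2 \<subseteq> VC (- C)"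
    by (auto simp: B1_def B2_def VC_def proj_def diag_mul_vec)
  have AP: "A *v (proj C *v x) = proj C *v (A *v x)" for x
    using assms(2) by (simp add: matrix_vector_mul_assoc block_diag_def)
  have eig: "\<exists>c. A *v w = c *s w" if "w \<in> B1 \<union> B2" for w
  proof -
    from that obtain k where "w = proj C *v v k \<or> w = v k - proj C *v v k"
      by (auto simp: B1_def B2_def)
    then have "A *v w = d0 k *s w"
      by (auto simp: AP Av matrix_vector_mult_diff_distrib vector_ssub_ldistrib vector_scalar_commute)
    then show ?thesis by blast
  qed
  have "v k \<in> vec.span (B1 \<union> B2)" for k
  proof -
    have "proj C *v v k + (v k - proj C *v v k) \<in> vec.span (B1 \<union> B2)"
      by (intro vec.span_add vec.span_base) (auto simp: B1_def B2_def)
    then show ?thesis by simp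
  qed
  then have "columns Q0 \<subseteq> vec.span (B1 \<union> B2)"
    by (auto simp: columns_def v_def)
  moreover have "vec.span (columns Q0) = UNIV"
    using Q0(1) matrix_right_invertible_span_columns[of Q0] by (auto simp: invertible_def)
  ultimately have spanB: "vec.span (B1 \<union> B2) = UNIV"
    by (metis vec.span_minimal vec.subspace_span top.extremum_unique)
  obtain S where S: "S \<subseteq> B1 \<union> B2" "vec.independent S" "B1 \<union> B2 \<subseteq> vec.span S"
    using vec.maximal_independent_subset by blast
  have spanS: "vec.span S = UNIV"
    using S(3) spanB by (metis vec.span_minimal vec.subspace_span top.extremum_unique)
  have finS: "finite S" using S(1) by (rule finite_subset) (simp add: B1_def B2_def)
  have cardS: "card S = CARD('n)"
    using S(2) spanS vec.dim_eq_card vec_dim_card by (metis vec.span_UNIV)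
  define S1 where "S1 = S \<inter> VC C"
  define S2 where "S2 = S \<inter> VC (- C)"
  have S12: "S = S1 \<union> S2" using S(1) B1V B2V by (auto simp: S1_def S2_def)
  have "0 \<notin> S" using S(2) vec.dependent_zero by blast
  moreover have "VC C \<inter> VC (- C) \<subseteq> {0}"
    by (auto simp: VC_def vec_eq_iff) blast
  ultimately have disj: "S1 \<inter> S2 = {}" by (auto simp: S1_def S2_def)
  have le: "card (S \<inter> VC D) \<le> card D" for D
  proof -
    have "card (S \<inter> VC D) \<le> vec.dim (VC D)"
      by (rule vec.independent_card_le_dim[OF Int_lower2 vec.independent_mono[OF S(2) Int_lower1]])
    then show ?thesis by (simp add: VC_def dim_substandard_cart)
  qed
  have "card S1 + card S2 = CARD('n)"
    using cardS S12 disj finS by (metis card_Un_disjoint finite_Un)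
  moreover have "card C + card (- C) = CARD('n)"
    by (metis card_Un_disjoint finite Compl_partition Int_lower1 Compl_disjoint)
  ultimately have "card S1 = card C" "card S2 = card (- C)"
    using le[of C] le[of "- C"] by (auto simp: S1_def S2_def)
  then obtain f1 f2 where f: "bij_betw f1 C S1" "bij_betw f2 (- C) S2"
    using finS S12 by (metis finite finite_Un finite_same_card_bij)
  define f where "f k = (if k \<in> C then f1 k else f2 k)" for k
  have rangef: "range f = S"
  proof -
    have "range f = f1 ` C \<union> f2 ` (- C)" by (auto simp: f_def)
    then show ?thesis using f S12 by (simp add: bij_betw_def)
  qed
  define Q where "Q = (\<chi> i k. f k $ i)"
  have "column k Q = f k" for k by (simp add: column_def Q_def vec_eq_iff)
  then have "columns Q = S" using rangef by (auto simp: columns_def)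
  then have "invertible Q"
    using matrix_right_invertible_span_columns[of Q] spanS by (auto simp: invertible_right_inverse)
  have "\<forall>k. \<exists>c. A *v f k = c *s f k" using eig S(1) rangef by blast
  then obtain d where d: "\<And>k. A *v f k = d k *s f k" by metis
  have "(A ** Q) $ i $ k = (A *v f k) $ i" for i k
    by (simp add: Q_def matrix_mul_nth matrix_vector_mult_def)
  then have "A ** Q = Q ** diag d"
    by (simp add: vec_eq_iff d diag_mul_right) (simp add: Q_def mult.commute)
  moreover have "block_diag C Q"
    using f by (auto simp: block_diag_nth Q_def f_def S1_def S2_def VC_def bij_betw_def)
  ultimately show ?thesis using \<open>invertible Q\<close> by (auto simp: eigenbasis_def)
qed

section \<open>Tuples without a common eigenvector\<close>

definition no_common_eigenvector :: "'k set \<Rightarrow> ('k \<Rightarrow> complex^'n^'n) \<Rightarrow> bool" where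
  "no_common_eigenvector K X \<longleftrightarrow> (\<forall>v. (\<forall>j\<in>K. \<exists>c. X j *v v = c *s v) \<longrightarrow> v = 0)"

text \<open>If fewer than \<open>card C\<close> coordinates with respect to the eigenbases have to vanish, some nonzero vector supported on
  \<open>C\<close> satisfies all these equations, and it is a common eigenvector with eigenvalues \<open>\<mu> j\<close>.\<close>

lemma no_common_eigenvector_count:
  fixes X :: "'k \<Rightarrow> complex^'n^'n"
  assumes "finite K" and ncev: "no_common_eigenvector K X"
    and eb: "\<And>j. j \<in> K \<Longrightarrow> eigenbasis (X j) (Q j) (d j)"
    and bd: "\<And>j. j \<in> K \<Longrightarrow> block_diag C (Q j)"
  shows "card C \<le> (\<Sum>j\<in>K. card {a\<in>C. d j a \<noteq> \<mu> j})"
proof (rule ccontr)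
  assume less: "\<not> ?thesis"
  define R where "R = (SIGMA j:K. {a\<in>C. d j a \<noteq> \<mu> j})"
  have "finite R" "card R < card C"
    using less \<open>finite K\<close> by (auto simp: R_def)
  from homogeneous_system_nontrivial[OF this(1) _ this(2),
      of "\<lambda>i r. matrix_inv (Q (fst r)) $ snd r $ i"]
  obtain c where c: "\<exists>i\<in>C. c i \<noteq> 0"
    "\<And>j a. (j, a) \<in> R \<Longrightarrow> (\<Sum>i\<in>C. c i * matrix_inv (Q j) $ a $ i) = 0"
    by (auto simp: Ball_def)
  define v where "v = (\<chi> i. if i \<in> C then c i else 0)"
  have v0: "v \<noteq> 0" using c(1) by (auto simp: v_def vec_eq_iff)
  have "X j *v v = \<mu> j *s v" if j: "j \<in> K" for j
  proof -
    have Q: "invertible (Q j)" "X j ** Q j = Q j ** diag (d j)"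
      using eb[OF j] by (auto simp: eigenbasis_def)
    define w where "w = matrix_inv (Q j) *v v"
    have vw: "v = Q j *v w" by (simp add: w_def vec_coords Q)
    have wa: "w $ a = (\<Sum>i\<in>C. c i * matrix_inv (Q j) $ a $ i)" for a
    proof -
      have "w $ a = (\<Sum>i\<in>UNIV. if i \<in> C then c i * matrix_inv (Q j) $ a $ i else 0)"
        by (auto simp: w_def matrix_vector_mult_def v_def intro!: sum.cong)
      then show ?thesis by (simp flip: sum.inter_filter)
    qed
    have "w $ a = 0" if "d j a \<noteq> \<mu> j" for a
    proof (cases "a \<in> C")
      case True
      then show ?thesis using wa c(2)[of j a] that j by (simp add: R_def)
    next
      case False
      have "matrix_inv (Q j) $ a $ i = 0" if "i \<in> C" for i
        using block_diag_inv[OF bd[OF j] Q(1)] that False by (auto simp: block_diag_nth)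
      then show ?thesis by (simp add: wa)
    qed
    then have "diag (d j) *v w = \<mu> j *s w"
      by (auto simp: vec_eq_iff diag_mul_vec)
    then show ?thesis
      by (metis vw Q(2) matrix_vector_mul_assoc vector_scalar_commute)
  qed
  then show False using ncev v0 unfolding no_common_eigenvector_def by blast
qed

text \<open>The rank of a matrix is defined through its rows. Passing to the transpose gives access to the
  span of the rows as an image of a linear map.\<close>

lemma eigenbasis_transpose:
  assumes "eigenbasis A Q d"
  shows "eigenbasis (transpose A) (transpose (matrix_inv Q)) d"
proof -
  have Q: "invertible Q" "A ** Q = Q ** diag d" using assms by (auto simp: eigenbasis_def)
  have "matrix_inv Q ** A = diag d ** matrix_inv Q"
    by (metis Q matrix_inv_cancel(2,3) matrix_mul_assoc)
  moreover have "transpose (diag d) = diag d" by (auto simp: transpose_def vec_eq_iff diag_nth)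
  ultimately have "transpose A ** transpose (matrix_inv Q) = transpose (matrix_inv Q) ** diag d"
    by (metis matrix_transpose_mul)
  moreover have "transpose (matrix_inv Q) ** transpose Q = mat 1"
    by (simp add: matrix_inv_mult(1)[OF Q(1)] flip: matrix_transpose_mul)
  then have "invertible (transpose (matrix_inv Q))"
    unfolding invertible_right_inverse by blast
  ultimately show ?thesis by (simp add: eigenbasis_def)
qed

lemma rank_eigenbasis_ge:
  fixes A :: "complex^'n^'n"
  assumes "eigenbasis A P d"
  shows "card {a. d a \<noteq> c} \<le> rank (A - mat c)"
proof -
  define Q where "Q = transpose (matrix_inv P)"
  have Q: "invertible Q" "transpose A ** Q = Q ** diag d"
    using eigenbasis_transpose[OF assms] by (auto simp: eigenbasis_def Q_def)
  define B where "B = transpose A - mat c"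
  define W where "W = {x::complex^'n. \<forall>i. i \<notin> {a. d a \<noteq> c} \<longrightarrow> x $ i = 0}"
  have inj: "inj ((*v) Q)" by (metis injI vec_coords(2) Q(1))
  have sub: "(*v) Q ` W \<subseteq> vec.span (columns B)"
  proof
    fix y assume "y \<in> (*v) Q ` W"
    then obtain x where x: "x \<in> W" "y = Q *v x" by auto
    define z where "z = (\<chi> i. x $ i / (d i - c))"
    have "(diag d - mat c) *v z = x"
    proof -
      have "((diag d - mat c) *v z) $ i = x $ i" for i
      proof -
        have "((diag d - mat c) *v z) $ i = (d i - c) * z $ i"
          by (simp add: matrix_vector_mult_diff_rdistrib mat_eq_diag diag_mul_vec left_diff_distrib)
        then show ?thesis using x(1) by (cases "d i = c") (auto simp: z_def W_def)
      qed
      then show ?thesis by (simp add: vec_eq_iff)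
    qed
    moreover have "B ** Q = Q ** (diag d - mat c)"
    proof -
      have "mat c ** Q = Q ** mat c"
        by (simp add: vec_eq_iff mat_eq_diag diag_mul_left diag_mul_right mult.commute)
      then show ?thesis by (simp add: B_def matrix_ring_simps Q)
    qed
    ultimately have "y = B *v (Q *v z)"
      by (metis x(2) matrix_vector_mul_assoc)
    then show "y \<in> vec.span (columns B)"
      by (simp add: matrix_vector_mult_in_columnspace_gen)
  qed
  have "card {a. d a \<noteq> c} = vec.dim W"
    unfolding W_def by (rule dim_substandard_cart[symmetric])
  also have "\<dots> = vec.dim ((*v) Q ` W)"
    by (rule vec.dim_image_eq[OF matrix_vector_mul_linear_gen inj_on_subset[OF inj subset_UNIV], symmetric])
  also have "\<dots> \<le> vec.dim (vec.span (columns B))" by (rule vec.dim_subset[OF sub])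
  also have "\<dots> = rank (A - mat c)" 
  proof -
    have "B = transpose (A - mat c)" by (auto simp: B_def transpose_def vec_eq_iff mat_def)
    then show ?thesis by (simp add: row_rank_def_gen)
  qed
  finally show ?thesis .
qed

section \<open>Perturbations in an off-diagonal block\<close>

text \<open>In the eigenbasis \<open>Q j\<close> the admissible directions \<open>T j\<close> are the matrices supported on pairs of
  indices in \<open>C \<times> - C\<close> with different eigenvalues: each of them is a commutator \<open>S X - X S\<close> with \<open>S\<close>
  in the same corner, and since corner matrices multiply to zero, conjugation by \<open>1 + S\<close> adds exactly
  this commutator. The displayed condition on the \<open>T j\<close> consists of \<open>card C * card (- C)\<close> linear
  equations for these coefficients.\<close>

lemma extension_exists:
  fixes X :: "'k \<Rightarrow> complex^'n^'n"
  assumes "finite K"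
    and eb: "\<And>j. j \<in> K \<Longrightarrow> eigenbasis (X j) (Q j) (d j)"
    and bd: "\<And>j. j \<in> K \<Longrightarrow> block_diag C (Q j)"
    and bdL: "\<And>j. j \<in> K \<Longrightarrow> block_diag C (L j)"
    and bdR: "\<And>j. j \<in> K \<Longrightarrow> block_diag C (R j)"
    and count: "card C * card (- C) <
      (\<Sum>j\<in>K. card {(a, b). a \<in> C \<and> b \<notin> C \<and> d j a \<noteq> d j b})"
  shows "\<exists>T. (\<exists>j\<in>K. T j \<noteq> 0) \<and> (\<forall>j\<in>K. corner C (T j)) \<and>
    (\<Sum>j\<in>K. L j ** T j ** R j) = 0 \<and>
    (\<forall>j\<in>K. \<forall>t::real. X j + t *\<^sub>R T j \<in> conj_class (X j))"
proof -
  define I where "I = (SIGMA j:K. {(a, b). a \<in> C \<and> b \<notin> C \<and> d j a \<noteq> d j b})"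
  define U where "U j = L j ** Q j" for j
  define V where "V j = matrix_inv (Q j) ** R j" for j
  have "finite I" "card (C \<times> (- C)) < card I"
    using count \<open>finite K\<close> by (auto simp: I_def card_cartesian_product)
  from homogeneous_system_nontrivial[OF _ this, of "\<lambda>x r. U (fst x) $ fst r $ fst (snd x) * V (fst x) $ snd (snd x) $ snd r"]
  obtain c where c: "\<exists>x\<in>I. c x \<noteq> 0"
    "\<And>i k. i \<in> C \<Longrightarrow> k \<notin> C \<Longrightarrow> (\<Sum>x\<in>I. c x * (U (fst x) $ i $ fst (snd x) * V (fst x) $ snd (snd x) $ k)) = 0"
    by auto
  \<comment> \<open>The solution, regarded as a tuple of matrices written in the eigenbases.\<close>
  define M where "M j = (\<chi> a b. if (j, a, b) \<in> I then c (j, a, b) else 0)" for j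
  define T where "T j = Q j ** M j ** matrix_inv (Q j)" for j
  have Mnz: "a \<in> C \<and> b \<notin> C \<and> d j a \<noteq> d j b" if "M j $ a $ b \<noteq> 0" for j a b
    using that by (auto simp: M_def I_def split: if_splits)
  have Q: "invertible (Q j)" "X j ** Q j = Q j ** diag (d j)" if "j \<in> K" for j
    using eb[OF that] by (auto simp: eigenbasis_def)
  have bdi: "block_diag C (matrix_inv (Q j))" if "j \<in> K" for j
    using bd[OF that] Q(1)[OF that] by (rule block_diag_inv)
  have cM: "corner C (M j)" for j using Mnz by (auto simp: corner_nth)
  have cT: "corner C (T j)" if "j \<in> K" for j
    unfolding T_def by (intro corner_mult_left corner_mult_right bd bdi that cM)
  have nz: "\<exists>j\<in>K. T j \<noteq> 0"
  proof -
    obtain j a b where j: "(j, a, b) \<in> I" "c (j, a, b) \<noteq> 0" using c(1) by auto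
    then have "M j \<noteq> 0" by (auto simp: M_def vec_eq_iff)
    moreover have "M j = matrix_inv (Q j) ** T j ** Q j" if "j \<in> K"
      by (simp add: T_def matrix_inv_cancel Q[OF that] flip: matrix_mul_assoc)
        (simp add: matrix_mul_assoc matrix_inv_cancel Q[OF that])
    moreover have "j \<in> K" using j by (auto simp: I_def)
    ultimately have "T j \<noteq> 0" by auto
    then show ?thesis using \<open>j \<in> K\<close> by blast
  qed
  have LTR: "L j ** T j ** R j = U j ** M j ** V j" for j
    by (simp add: U_def V_def T_def matrix_mul_assoc)
  have "(\<Sum>j\<in>K. L j ** T j ** R j) $ i $ k = 0" for i k
  proof (cases "i \<in> C \<and> k \<notin> C")
    case True
    have "(\<Sum>j\<in>K. L j ** T j ** R j) $ i $ k
        = (\<Sum>j\<in>K. \<Sum>(a, b)\<in>UNIV. U j $ i $ a * M j $ a $ b * V j $ b $ k)"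
    proof -
      have "(U j ** M j ** V j) $ i $ k = (\<Sum>b\<in>UNIV. \<Sum>a\<in>UNIV. U j $ i $ a * M j $ a $ b * V j $ b $ k)" for j
        by (simp add: matrix_mul_nth sum_distrib_right)
      also have "\<dots> j = (\<Sum>(a, b)\<in>UNIV. U j $ i $ a * M j $ a $ b * V j $ b $ k)" for j
        unfolding UNIV_Times_UNIV[symmetric] sum.cartesian_product[symmetric] by (rule sum.swap)
      finally show ?thesis by (simp add: LTR)
    qed
    also have "\<dots> = (\<Sum>j\<in>K. \<Sum>(a, b)\<in>{(a, b). a \<in> C \<and> b \<notin> C \<and> d j a \<noteq> d j b}.
        c (j, a, b) * (U j $ i $ a * V j $ b $ k))"
    proof (rule sum.cong[OF refl])
      fix j assume "j \<in> K"
      then show "(\<Sum>(a, b)\<in>UNIV. U j $ i $ a * M j $ a $ b * V j $ b $ k) =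
        (\<Sum>(a, b)\<in>{(a, b). a \<in> C \<and> b \<notin> C \<and> d j a \<noteq> d j b}. c (j, a, b) * (U j $ i $ a * V j $ b $ k))"
        by (intro sum.mono_neutral_cong_right) (auto simp: M_def I_def split: if_splits)
    qed
    also have "\<dots> = (\<Sum>x\<in>I. c x * (U (fst x) $ i $ fst (snd x) * V (fst x) $ snd (snd x) $ k))"
      unfolding I_def using \<open>finite K\<close>
      by (subst sum.Sigma) (auto simp: case_prod_unfold intro!: sum.cong)
    also have "\<dots> = 0" using c(2) True by blast
    finally show ?thesis .
  next
    case False
    have "(L j ** T j ** R j) $ i $ k = 0" if "j \<in> K" for j
    proof -
      have "corner C (L j ** T j ** R j)"
        by (intro corner_mult_left corner_mult_right bdL bdR that cT)
      then show ?thesis using False by (auto simp: corner_nth)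
    qed
    then show ?thesis by simp
  qed
  then have sum0: "(\<Sum>j\<in>K. L j ** T j ** R j) = 0" by (simp add: vec_eq_iff)
  have "X j + t *\<^sub>R T j \<in> conj_class (X j)" if j: "j \<in> K" for j and t :: real
  proof -
    \<comment> \<open>Dividing by the eigenvalue difference solves \<open>S X - X S = t T\<close> in the eigenbasis; where the
    difference is zero, so is the numerator.\<close>
    define s where "s = (\<chi> a b. of_real t * M j $ a $ b / (d j b - d j a))"
    define S where "S = Q j ** s ** matrix_inv (Q j)"
    have cs: "corner C s" using cM[of j] by (auto simp: corner_nth s_def)
    have cS: "corner C S"
      unfolding S_def by (intro corner_mult_left corner_mult_right bd bdi j cs)
    have "s ** diag (d j) - diag (d j) ** s = t *\<^sub>R M j"
    proof -
      have "s $ a $ b * d j b - d j a * s $ a $ b = t *\<^sub>R M j $ a $ b" for a b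
      proof (cases "d j a = d j b")
        case True
        then show ?thesis using Mnz[of j a b] by (auto simp: s_def)
      next
        case False
        have "s $ a $ b * d j b - d j a * s $ a $ b = s $ a $ b * (d j b - d j a)"
          by (simp add: algebra_simps)
        then show ?thesis using False by (simp add: s_def scaleR_conv_of_real)
      qed
      then show ?thesis by (simp add: vec_eq_iff diag_mul_left diag_mul_right)
    qed
    then have "t *\<^sub>R T j = Q j ** (s ** diag (d j) - diag (d j) ** s) ** matrix_inv (Q j)"
      by (simp add: T_def vec_eq_iff matrix_mul_nth scaleR_sum_right sum_distrib_right)
    also have "\<dots> = S ** X j - X j ** S"
    proof -
      have X: "X j = Q j ** diag (d j) ** matrix_inv (Q j)"
        by (metis Q[OF j] matrix_inv_cancel(3))
      have "S ** X j = Q j ** s ** diag (d j) ** matrix_inv (Q j)"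
        unfolding X S_def by (simp add: matrix_mul_assoc matrix_inv_cancel Q[OF j])
      moreover have "X j ** S = Q j ** diag (d j) ** s ** matrix_inv (Q j)"
        unfolding X S_def by (simp add: matrix_mul_assoc matrix_inv_cancel Q[OF j])
      ultimately show ?thesis by (simp add: matrix_ring_simps matrix_mul_assoc)
    qed
    finally have tT: "t *\<^sub>R T j = S ** X j - X j ** S" .
    have SS: "S ** S = 0" by (rule corner_mult_zero[OF cS cS])
    have "T j ** S = 0" by (rule corner_mult_zero[OF cT[OF j] cS])
    then have tTS: "(t *\<^sub>R T j) ** S = 0"
      by (simp add: vec_eq_iff matrix_mul_nth flip: scaleR_sum_right)
    have "(mat 1 + S) ** (mat 1 - S) = mat 1" by (simp add: matrix_ring_simps SS)
    then have "invertible (mat 1 + S)" by (auto simp: invertible_right_inverse)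
    moreover have "(X j + t *\<^sub>R T j) ** (mat 1 + S) = (mat 1 + S) ** X j"
      by (simp add: matrix_mul_add_left matrix_add_ldistrib tTS) (simp add: tT)
    ultimately show ?thesis by (rule conj_classI)
  qed
  then show ?thesis using nz cT sum0 by blast
qed

section \<open>Multiplicities in two blocks\<close>

text \<open>For \<open>f\<close> listing the eigenvalues of a matrix in an eigenbasis adapted to \<open>C\<close>, this is the
  multiplicity of the eigenvalue \<open>x\<close> in the diagonal block \<open>C\<close>.\<close>

definition mult_in :: "'a set \<Rightarrow> ('a \<Rightarrow> 'b) \<Rightarrow> 'b \<Rightarrow> nat" where
  "mult_in C f x = card {a\<in>C. f a = x}"

lemma card_neq_eq:
  assumes "finite C" shows "card {a\<in>C. f a \<noteq> x} = card C - mult_in C f x"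
proof -
  have "card (C - {a\<in>C. f a = x}) = card C - mult_in C f x"
    unfolding mult_in_def by (rule card_Diff_subset) (use assms in auto)
  moreover have "C - {a\<in>C. f a = x} = {a\<in>C. f a \<noteq> x}" by auto
  ultimately show ?thesis by simp
qed

lemma mult_in_le: "finite C \<Longrightarrow> mult_in C f x \<le> card C"
  unfolding mult_in_def by (rule card_mono) auto

lemma mult_in_pos: "finite C \<Longrightarrow> a \<in> C \<Longrightarrow> mult_in C f (f a) > 0"
  unfolding mult_in_def by (auto simp: card_gt_0_iff)

lemma mult_in_eq_0: "finite C \<Longrightarrow> mult_in C f x = 0 \<longleftrightarrow> x \<notin> f ` C"
  unfolding mult_in_def by auto

lemma mult_in_ge1: "finite C \<Longrightarrow> x \<in> f ` C \<Longrightarrow> 1 \<le> mult_in C f x"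
  using mult_in_eq_0[of C f x] by (auto simp: Suc_le_eq)

lemma sum_mult_in:
  assumes "finite C" shows "(\<Sum>x\<in>f ` C. mult_in C f x) = card C"
  using sum.group[of C "f ` C" f "\<lambda>_. 1 :: nat"] assms by (simp add: mult_in_def)

lemma card_pairs_neq:
  assumes "finite C" "finite D"
  shows "card {(a, b). a \<in> C \<and> b \<in> D \<and> f a \<noteq> f b} = (\<Sum>b\<in>D. card {a\<in>C. f a \<noteq> f b})"
proof -
  have "{(a, b). a \<in> C \<and> b \<in> D \<and> f a \<noteq> f b} = (\<lambda>(b, a). (a, b)) ` (SIGMA b:D. {a\<in>C. f a \<noteq> f b})"
    by (auto simp: image_iff)
  moreover have "inj_on (\<lambda>(b, a). (a, b)) (SIGMA b:D. {a\<in>C. f a \<noteq> f b})"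
    by (auto simp: inj_on_def)
  ultimately show ?thesis using assms by (simp add: card_image)
qed

text \<open>The lower bound with \<open>\<mu> j = f j b\<close> says that every \<open>b\<close> contributes at least \<open>card C\<close> to the left
  side of \<open>tight\<close>, so every contribution equals \<open>card C\<close>. Replacing a single \<open>\<mu> j\<close> by another
  value \<open>x\<close> cannot lower the sum, hence \<open>f j b\<close> is a value of largest multiplicity in \<open>C\<close>.\<close>

lemma tight_count_maximal:
  fixes f :: "'k \<Rightarrow> 'a \<Rightarrow> 'b"
  assumes fin: "finite K" "finite C" "finite D"
    and beta: "\<And>\<mu>. card C \<le> (\<Sum>j\<in>K. card {a\<in>C. f j a \<noteq> \<mu> j})"
    and tight: "(\<Sum>j\<in>K. card {(a, b). a \<in> C \<and> b \<in> D \<and> f j a \<noteq> f j b}) \<le> card C * card D"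
    and b: "b \<in> D"
  shows "(\<Sum>j\<in>K. card {a\<in>C. f j a \<noteq> f j b}) = card C"
    and "j \<in> K \<Longrightarrow> mult_in C (f j) x \<le> mult_in C (f j) (f j b)"
proof -
  define g where "g b = (\<Sum>j\<in>K. card {a\<in>C. f j a \<noteq> f j b})" for b
  have ge: "card C \<le> g b" for b unfolding g_def by (rule beta)
  have "(\<Sum>b\<in>D. g b) \<le> (\<Sum>b\<in>D. card C)"
    using tight fin by (simp add: g_def card_pairs_neq sum.swap[of _ D K] mult.commute)
  moreover have "(\<Sum>b\<in>D. card C) < (\<Sum>b\<in>D. g b)" if "card C < g b"
    by (rule sum_strict_mono_ex1) (use fin ge that b in auto)
  ultimately have eq: "g b = card C" using ge[of b] by fastforce
  then show "(\<Sum>j\<in>K. card {a\<in>C. f j a \<noteq> f j b}) = card C" by (simp add: g_def)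
  assume j: "j \<in> K"
  \<comment> \<open>Comparison of \<open>\<mu> i = f i b\<close> with its modification at the single index \<open>j\<close>.\<close>
  let ?\<mu> = "(\<lambda>i. f i b)(j := x)"
  have "card C \<le> (\<Sum>i\<in>K. card {a\<in>C. f i a \<noteq> ?\<mu> i})" by (rule beta)
  also have "\<dots> = card {a\<in>C. f j a \<noteq> x} + (\<Sum>i\<in>K - {j}. card {a\<in>C. f i a \<noteq> f i b})"
    by (subst sum.remove[OF fin(1) j]) simp
  finally have "card C \<le> \<dots>" .
  moreover have "card C = card {a\<in>C. f j a \<noteq> f j b} + (\<Sum>i\<in>K - {j}. card {a\<in>C. f i a \<noteq> f i b})"
    using eq sum.remove[OF fin(1) j, of "\<lambda>i. card {a\<in>C. f i a \<noteq> f i b}"] by (simp add: g_def)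
  ultimately have "card {a\<in>C. f j a \<noteq> f j b} \<le> card {a\<in>C. f j a \<noteq> x}" by linarith
  then show "mult_in C (f j) x \<le> mult_in C (f j) (f j b)"
    using mult_in_le[OF fin(2), of "f j" x] mult_in_le[OF fin(2), of "f j" "f j b"]
    by (simp add: card_neq_eq[OF fin(2)])
qed

text \<open>Maximality in both directions shows that the two blocks have the same eigenvalues and that in
  each block all eigenvalues of one matrix have equal multiplicity. With \<open>s j\<close> eigenvalues, the
  \<open>j\<close>-th term of the tight sum is \<open>card C * (1 - 1 / s j)\<close>, and the terms add up to \<open>card C\<close>. Nonzero
  terms are at least \<open>card C / 2\<close> and less than \<open>card C\<close>, so there are exactly two, with \<open>s j = 2\<close>.\<close>

lemma tight_count_halves:
  fixes f :: "'k \<Rightarrow> 'a \<Rightarrow> 'b"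
  assumes fin: "finite K" "finite C" "finite D" and ne: "C \<noteq> {}" "D \<noteq> {}"
    and betaC: "\<And>\<mu>. card C \<le> (\<Sum>j\<in>K. card {a\<in>C. f j a \<noteq> \<mu> j})"
    and betaD: "\<And>\<mu>. card D \<le> (\<Sum>j\<in>K. card {a\<in>D. f j a \<noteq> \<mu> j})"
    and tight: "(\<Sum>j\<in>K. card {(a, b). a \<in> C \<and> b \<in> D \<and> f j a \<noteq> f j b}) \<le> card C * card D"
  shows "\<And>j. j \<in> K \<Longrightarrow> f j ` C = f j ` D"
    and "card {j\<in>K. card (f j ` C) \<noteq> 1} = 2"
    and "\<And>j. j \<in> K \<Longrightarrow> card (f j ` C) \<noteq> 1 \<Longrightarrow>
      card (f j ` C) = 2 \<and> (\<forall>x\<in>f j ` C. 2 * mult_in C (f j) x = card C)"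
proof -
  have tight': "(\<Sum>j\<in>K. card {(a, b). a \<in> D \<and> b \<in> C \<and> f j a \<noteq> f j b}) \<le> card D * card C"
  proof -
    have "card {(a, b). a \<in> D \<and> b \<in> C \<and> f j a \<noteq> f j b} = card {(a, b). a \<in> C \<and> b \<in> D \<and> f j a \<noteq> f j b}" for j
    proof -
      have "{(a, b). a \<in> D \<and> b \<in> C \<and> f j a \<noteq> f j b}
          = (\<lambda>(a, b). (b, a)) ` {(a, b). a \<in> C \<and> b \<in> D \<and> f j a \<noteq> f j b}"
        by (auto simp: image_iff)
      then show ?thesis by (simp add: card_image inj_on_def split_def prod_eq_iff)
    qed
    then show ?thesis using tight by (simp add: mult.commute)
  qed
  note maxC = tight_count_maximal[OF fin betaC tight]
  note maxD = tight_count_maximal[OF fin(1,3,2) betaD tight']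
  have imC: "f j b \<in> f j ` C" if "j \<in> K" "b \<in> D" for j b
  proof -
    obtain a where "a \<in> C" using ne by auto
    then have "0 < mult_in C (f j) (f j a)" using fin(2) by (rule mult_in_pos[rotated])
    also have "\<dots> \<le> mult_in C (f j) (f j b)" using maxC(2) that by blast
    finally show ?thesis using mult_in_eq_0[OF fin(2), of "f j" "f j b"] by auto
  qed
  have imD: "f j a \<in> f j ` D" if "j \<in> K" "a \<in> C" for j a
  proof -
    obtain b where "b \<in> D" using ne by auto
    then have "0 < mult_in D (f j) (f j b)" using fin(3) by (rule mult_in_pos[rotated])
    also have "\<dots> \<le> mult_in D (f j) (f j a)" using maxD(2) that by blast
    finally show ?thesis using mult_in_eq_0[OF fin(3), of "f j" "f j a"] by auto
  qed
  show im: "f j ` C = f j ` D" if "j \<in> K" for j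
    using imC imD that by blast
  obtain b where b: "b \<in> D" using ne by auto
  define m where "m j = mult_in C (f j) (f j b)" for j
  define g where "g j = card C - m j" for j
  have mult: "mult_in C (f j) x = m j" if "j \<in> K" "x \<in> f j ` C" for j x
  proof -
    have "x \<in> f j ` D" using im[OF that(1)] that(2) by simp
    then obtain b' where "x = f j b'" "b' \<in> D" by blast
    then show ?thesis using maxC(2)[of _ j] b that(1) unfolding m_def by (meson le_antisym)
  qed
  have card_eq: "card C = card (f j ` C) * m j" if "j \<in> K" for j
    using sum_mult_in[OF fin(2), of "f j"] mult[OF that] by simp
  have gsum: "(\<Sum>j\<in>K. g j) = card C"
    using maxC(1)[OF b] by (simp add: g_def m_def card_neq_eq[OF fin(2)])
  have mle: "m j \<le> card C" for j unfolding m_def by (rule mult_in_le[OF fin(2)])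
  have mpos: "0 < m j" if "j \<in> K" for j
    using card_eq[OF that] fin ne by (metis card_0_eq gr0I mult_0_right)
  have cpos: "0 < card C" using fin ne by (simp add: card_gt_0_iff)
  have s0: "0 < card (f j ` C)" for j using fin ne by (simp add: card_gt_0_iff)
  have g0: "g j = 0" if "j \<in> K" "card (f j ` C) = 1" for j
    using card_eq[OF that(1)] that(2) by (simp add: g_def)
  \<comment> \<open>The indices with nonzero terms; their number is determined by bounding the terms.\<close>
  define K' where "K' = {j\<in>K. card (f j ` C) \<noteq> 1}"
  have finK': "finite K'" using fin by (simp add: K'_def)
  have gK': "(\<Sum>j\<in>K'. g j) = card C"
    unfolding gsum[symmetric] K'_def
    by (rule sum.mono_neutral_left) (use fin g0 in auto)
  have half: "card C \<le> 2 * g j" if "j \<in> K'" for j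
  proof -
    have "2 \<le> card (f j ` C)" using that s0[of j] by (auto simp: K'_def)
    then have "2 * m j \<le> card C" using card_eq[of j] that by (auto simp: K'_def)
    then show ?thesis by (simp add: g_def)
  qed
  have small: "g j < card C" if "j \<in> K'" for j
    using mpos[of j] mle[of j] cpos that by (auto simp: g_def K'_def)
  have "card K' * card C = (\<Sum>j\<in>K'. card C)" by simp
  also have "\<dots> \<le> (\<Sum>j\<in>K'. 2 * g j)" by (rule sum_mono) (use half in auto)
  also have "\<dots> = 2 * card C" by (simp add: gK' flip: sum_distrib_left)
  finally have "card K' \<le> 2" using cpos by simp
  moreover have "card K' \<noteq> 0" using gK' cpos finK' by auto
  moreover have "card K' \<noteq> 1"
  proof
    assume "card K' = 1"
    then obtain j where "K' = {j}" by (auto simp: card_1_singleton_iff)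
    then show False using gK' small[of j] by simp
  qed
  ultimately have K'2: "card K' = 2" by linarith
  then show "card {j\<in>K. card (f j ` C) \<noteq> 1} = 2" by (simp add: K'_def)
  show "card (f j ` C) = 2 \<and> (\<forall>x\<in>f j ` C. 2 * mult_in C (f j) x = card C)"
    if j: "j \<in> K" "card (f j ` C) \<noteq> 1" for j
  proof -
    have jK': "j \<in> K'" using j by (simp add: K'_def)
    have "card (K' - {j}) = 1" using K'2 jK' finK' by simp
    then obtain i where "K' - {j} = {i}" by (auto simp: card_1_singleton_iff)
    then have "i \<in> K'" "(\<Sum>j\<in>K'. g j) = g j + g i"
      using sum.remove[OF finK' jK', of g] by auto
    then have "2 * g j = card C" using half[OF jK'] half[of i] gK' by linarith
    then have "2 * m j = card C" using mle[of j] by (simp add: g_def)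
    then show ?thesis using card_eq[OF j(1)] mult[OF j(1)] mpos[OF j(1)] by auto
  qed
qed

section \<open>The number of pairs of distinct eigenvalues\<close>

lemma most_frequent_value: "\<exists>x\<in>range f. \<forall>y. mult_in UNIV f y \<le> mult_in UNIV f x"
  for f :: "'a::finite \<Rightarrow> 'b"
proof -
  obtain a :: 'a where True by simp
  have "\<exists>x. x \<in> range f \<and> (\<forall>y. y \<in> range f \<longrightarrow> mult_in UNIV f y \<le> mult_in UNIV f x)"
    by (rule ex_has_greatest_nat[of _ "f a" _ "Suc CARD('a)"])
      (auto simp: mult_in_le less_Suc_eq_le)
  then obtain x where x: "x \<in> range f" "\<And>y. y \<in> range f \<Longrightarrow> mult_in UNIV f y \<le> mult_in UNIV f x"
    by blast
  have "mult_in UNIV f y \<le> mult_in UNIV f x" for y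
    using x(2)[of y] mult_in_eq_0[of UNIV f y] by (cases "y \<in> range f") auto
  then show ?thesis using x(1) by blast
qed

text \<open>The number of pairs with different values is \<open>n * (n - M)\<close> if all values have multiplicity \<open>M\<close>.
  For \<open>M\<close> the largest multiplicity, the excess is what the smaller multiplicities add to this.\<close>

definition excess :: "('a::finite \<Rightarrow> 'b) \<Rightarrow> nat \<Rightarrow> nat" where
  "excess f M = (\<Sum>x\<in>range f. mult_in UNIV f x * (M - mult_in UNIV f x))"

lemma card_pairs_excess:
  fixes f :: "'a::finite \<Rightarrow> 'b"
  assumes "\<And>x. mult_in UNIV f x \<le> M" "M \<le> CARD('a)"
  shows "card {(a, b). f a \<noteq> f b} = CARD('a) * (CARD('a) - M) + excess f M"
proof -
  have "card {(a, b). f a \<noteq> f b} = (\<Sum>b\<in>UNIV. CARD('a) - mult_in UNIV f (f b))"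
    using card_pairs_neq[of UNIV UNIV f] card_neq_eq[of UNIV f] by simp
  also have "\<dots> = (\<Sum>b\<in>UNIV. (CARD('a) - M) + (M - mult_in UNIV f (f b)))"
    by (rule sum.cong[OF refl]) (use assms in simp)
  also have "\<dots> = CARD('a) * (CARD('a) - M) + (\<Sum>b\<in>UNIV. M - mult_in UNIV f (f b))"
    by (simp add: sum.distrib)
  also have "(\<Sum>b\<in>UNIV. M - mult_in UNIV f (f b))
      = (\<Sum>x\<in>range f. \<Sum>b | b \<in> UNIV \<and> f b = x. M - mult_in UNIV f (f b))"
    by (rule sum.group[symmetric]) auto
  also have "\<dots> = excess f M"
    unfolding excess_def by (rule sum.cong[OF refl]) (simp add: mult_in_def)
  finally show ?thesis .
qed

text \<open>Outside a value of multiplicity \<open>M\<close> there remain \<open>n - M\<close> indices, so every other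
  multiplicity is at most \<open>n - M\<close>.\<close>

lemma excess_dominant:
  fixes f :: "'a::finite \<Rightarrow> 'b"
  assumes "x0 \<in> range f" "mult_in UNIV f x0 = M"
  shows "(CARD('a) - M) * (M - (CARD('a) - M)) \<le> excess f M"
proof -
  let ?r = "CARD('a) - M"
  have sum: "(\<Sum>x\<in>range f - {x0}. mult_in UNIV f x) = ?r"
    using sum.remove[of "range f" x0 "mult_in UNIV f"] assms sum_mult_in[of UNIV f] by simp
  then have le: "mult_in UNIV f x \<le> ?r" if "x \<in> range f - {x0}" for x
    using member_le_sum[of x "range f - {x0}" "mult_in UNIV f"] that by simp
  have "?r * (M - ?r) = (\<Sum>x\<in>range f - {x0}. mult_in UNIV f x * (M - ?r))"
    by (simp add: sum flip: sum_distrib_right)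
  also have "\<dots> \<le> (\<Sum>x\<in>range f - {x0}. mult_in UNIV f x * (M - mult_in UNIV f x))"
    by (rule sum_mono) (use le in \<open>simp add: diff_le_mono2\<close>)
  also have "\<dots> \<le> excess f M"
    unfolding excess_def by (rule sum_mono2) auto
  finally show ?thesis .
qed

lemma mult_gap: "1 \<le> m \<Longrightarrow> m < M \<Longrightarrow> M - 1 \<le> m * (M - m)" for m M :: nat
proof -
  assume "1 \<le> m" "m < M"
  then obtain u v where "m = Suc u" "M = m + Suc v" by (metis add_Suc_right less_imp_Suc_add One_nat_def Suc_le_D)
  then show ?thesis by simp
qed

lemma small_gap: "n - 2 \<le> 2 * (r * (n - 2 * r))" if "0 < r" "2 * r < n" for n r :: nat
proof -
  have "1 * (n - 2 * r - 1) + r * 1 \<le> r * (n - 2 * r - 1) + r * 1"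
    using that(1) by (intro add_right_mono mult_right_mono) auto
  also have "\<dots> = r * (n - 2 * r - 1 + 1)" by (rule distrib_left[symmetric])
  also have "n - 2 * r - 1 + 1 = n - 2 * r" using that(2) by linarith
  finally show ?thesis using that by linarith
qed

lemma large_gap: "n - 2 \<le> r * (n - 2 * r)" if "0 < r" "2 * r + 2 \<le> n" for n r :: nat
proof -
  have "1 * (n - 2 * r - 2) + r * 2 \<le> r * (n - 2 * r - 2) + r * 2"
    using that(1) by (intro add_right_mono mult_right_mono) auto
  also have "\<dots> = r * (n - 2 * r - 2 + 2)" by (rule distrib_left[symmetric])
  also have "n - 2 * r - 2 + 2 = n - 2 * r" using that(2) by linarith
  finally show ?thesis using that by linarith
qed

lemma excess_single:
  fixes f :: "'a::finite \<Rightarrow> 'b"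
  assumes "x \<in> range f" "mult_in UNIV f x < M"
  shows "M - 1 \<le> excess f M"
proof -
  have "1 \<le> mult_in UNIV f x" using assms by (intro mult_in_ge1) auto
  then have "M - 1 \<le> mult_in UNIV f x * (M - mult_in UNIV f x)"
    by (rule mult_gap[OF _ assms(2)])
  also have "\<dots> \<le> excess f M"
    unfolding excess_def by (rule member_le_sum) (use assms in auto)
  finally show ?thesis .
qed

lemma excess_double:
  fixes f :: "'a::finite \<Rightarrow> 'b"
  assumes "x \<in> range f" "mult_in UNIV f x < M" "y \<in> range f" "mult_in UNIV f y < M" "x \<noteq> y"
  shows "2 * (M - 1) \<le> excess f M"
proof -
  have ge: "1 \<le> mult_in UNIV f x" "1 \<le> mult_in UNIV f y"
    using assms by (intro mult_in_ge1; simp)+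
  then have "2 * (M - 1) \<le> (\<Sum>x\<in>{x,y}. mult_in UNIV f x * (M - mult_in UNIV f x))"
    using mult_gap[OF ge(1) assms(2)] mult_gap[OF ge(2) assms(4)] assms(5) by simp
  also have "\<dots> \<le> excess f M"
    unfolding excess_def by (rule sum_mono2) (use assms in auto)
  finally show ?thesis .
qed

text \<open>With \<open>r j = n - M j\<close>, where \<open>M j\<close> is the largest multiplicity of \<open>f j\<close>, the sum on the right is
  \<open>n * (\<Sum>j. r j) + (\<Sum>j. E j)\<close> with excesses \<open>E j\<close>, and \<open>(\<Sum>j. r j) \<ge> n\<close>. If the latter
  inequality is strict, the bound is immediate. Otherwise the excesses have to provide \<open>n - 2\<close>. A
  term with \<open>0 < 2 * r j < n\<close> has excess at least \<open>r j * (n - 2 * r j) \<ge> (n - 2) / 2\<close>, and two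
  such terms exist as soon as three of the \<open>f j\<close> are not constant. The remaining case of two
  nonconstant functions with \<open>r i + r j = n\<close> is treated according to the size of \<open>r i\<close>.\<close>

lemma card_pairs_lower_bound:
  fixes f :: "'k \<Rightarrow> 'a::finite \<Rightarrow> 'b"
  assumes K: "finite K" and n2: "2 \<le> CARD('a)"
    and beta: "\<And>\<mu>. CARD('a) \<le> (\<Sum>j\<in>K. card {a. f j a \<noteq> \<mu> j})"
    and notA: "CARD('a) \<ge> 4 \<Longrightarrow> even CARD('a) \<Longrightarrow> card {j\<in>K. card (range (f j)) \<noteq> 1} = 2 \<Longrightarrow>
      (\<And>j. j \<in> K \<Longrightarrow> card (range (f j)) \<noteq> 1 \<Longrightarrow>
         card (range (f j)) = 2 \<and> (\<forall>x\<in>range (f j). 2 * mult_in UNIV (f j) x = CARD('a))) \<Longrightarrow> False"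
  shows "(CARD('a))\<^sup>2 + CARD('a) - 2 \<le> (\<Sum>j\<in>K. card {(a, b). f j a \<noteq> f j b})"
proof -
  let ?n = "CARD('a)"
  have "\<forall>j. \<exists>x. x \<in> range (f j) \<and> (\<forall>y. mult_in UNIV (f j) y \<le> mult_in UNIV (f j) x)"
    using most_frequent_value[of "f _"] by (simp add: Bex_def)
  then obtain x where "\<forall>j. x j \<in> range (f j) \<and> (\<forall>y. mult_in UNIV (f j) y \<le> mult_in UNIV (f j) (x j))"
    unfolding choice_iff by (elim exE)
  then have x: "\<And>j. x j \<in> range (f j)" "\<And>j y. mult_in UNIV (f j) y \<le> mult_in UNIV (f j) (x j)"
    by simp_all
  define M where "M j = mult_in UNIV (f j) (x j)" for j
  define r where "r j = ?n - M j" for j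
  define E where "E j = excess (f j) (M j)" for j
  have Mn: "M j \<le> ?n" for j unfolding M_def by (rule mult_in_le) simp
  have Mpos: "0 < M j" for j
    using x(1)[of j] mult_in_eq_0[of UNIV "f j" "x j"] unfolding M_def by auto
  have N: "card {(a, b). f j a \<noteq> f j b} = ?n * r j + E j" for j
    unfolding r_def E_def by (rule card_pairs_excess) (use x(2) Mn in \<open>auto simp: M_def\<close>)
  have rsum: "?n \<le> (\<Sum>j\<in>K. r j)"
    using beta[of x] by (simp add: r_def M_def card_neq_eq[of UNIV, simplified])
  have total: "(\<Sum>j\<in>K. card {(a, b). f j a \<noteq> f j b}) = ?n * (\<Sum>j\<in>K. r j) + (\<Sum>j\<in>K. E j)"
    by (simp add: N sum.distrib sum_distrib_left)
  show ?thesis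
  proof (cases "?n + 1 \<le> (\<Sum>j\<in>K. r j)")
    case True
    then have "?n * (?n + 1) \<le> ?n * (\<Sum>j\<in>K. r j)" by (rule mult_le_mono2)
    then show ?thesis unfolding total by (simp add: power2_eq_square)
  next
    case False
    then have rn: "(\<Sum>j\<in>K. r j) = ?n" using rsum by linarith
    have dom: "r j * (?n - 2 * r j) \<le> E j" for j
    proof -
      have "M j - r j = ?n - 2 * r j" using Mn[of j] by (auto simp: r_def)
      then show ?thesis
        using excess_dominant[of "x j" "f j" "M j"] x(1) by (simp add: r_def E_def M_def)
    qed
    have r_lt: "r j < ?n" for j using Mpos[of j] n2 by (simp add: r_def)
    define K' where "K' = {j\<in>K. r j \<noteq> 0}"
    have K': "finite K'" "K' \<subseteq> K" using K by (auto simp: K'_def)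
    have rK': "(\<Sum>j\<in>K'. r j) = ?n"
      unfolding rn[symmetric] K'_def by (rule sum.mono_neutral_left) (use K in auto)
    have const: "r j = 0 \<longleftrightarrow> card (range (f j)) = 1" for j
    proof
      assume "r j = 0"
      then have M: "M j = ?n" using Mn[of j] by (simp add: r_def)
      have "{a. f j a = x j} = UNIV"
        by (rule card_subset_eq) (use M in \<open>simp_all add: M_def mult_in_def\<close>)
      then have "range (f j) = {x j}" using x(1)[of j] by blast
      then show "card (range (f j)) = 1" by simp
    next
      assume "card (range (f j)) = 1"
      then obtain y where "range (f j) = {y}" by (auto simp: card_1_singleton_iff)
      then have "range (f j) = {x j}" using x(1)[of j] by simp
      then have "{a. f j a = x j} = UNIV" by auto
      then show "r j = 0" by (simp add: r_def M_def mult_in_def)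
    qed
    have EK: "(\<Sum>j\<in>J. E j) \<le> (\<Sum>j\<in>K. E j)" if "J \<subseteq> K'" for J
      by (rule sum_mono2) (use K K' that in auto)
    have EK1: "E j \<le> (\<Sum>j\<in>K. E j)" if "j \<in> K'" for j
      using EK[of "{j}"] that by simp
    have EK2: "E i + E j \<le> (\<Sum>j\<in>K. E j)" if "i \<in> K'" "j \<in> K'" "i \<noteq> j" for i j
      using EK[of "{i,j}"] that by simp
    have small: "?n - 2 \<le> 2 * E j" if "j \<in> K'" "2 * r j < ?n" for j
    proof -
      have "?n - 2 \<le> 2 * (r j * (?n - 2 * r j))"
        using that by (intro small_gap) (auto simp: K'_def)
      then show ?thesis using dom[of j] by linarith
    qed
    have "card K' \<noteq> 0" using rK' n2 K' by auto
    moreover have "card K' \<noteq> 1"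
    proof
      assume "card K' = 1"
      then obtain j where "K' = {j}" by (auto simp: card_1_singleton_iff)
      then show False using rK' r_lt[of j] by simp
    qed
    ultimately consider "card K' \<ge> 3" | "card K' = 2" by linarith
    then have "?n - 2 \<le> (\<Sum>j\<in>K. E j)"
    proof cases
      case 1
      \<comment> \<open>Two terms \<open>r\<close> of size at least \<open>n / 2\<close> and a third positive one would exceed the sum \<open>n\<close>.\<close>
      have "\<exists>i\<in>K'. \<exists>j\<in>K'. i \<noteq> j \<and> 2 * r i < ?n \<and> 2 * r j < ?n"
      proof -
        obtain i j k where ijk: "i \<in> K'" "j \<in> K'" "k \<in> K'" "i \<noteq> j" "i \<noteq> k" "j \<noteq> k"
        proof -
          obtain S where S: "S \<subseteq> K'" "card S = 3" using 1 obtain_subset_with_card_n by metis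
          then show ?thesis using that by (auto simp: card_3_iff)
        qed
        have "(\<Sum>j\<in>{i,j,k}. r j) \<le> (\<Sum>j\<in>K'. r j)"
          by (rule sum_mono2) (use K' ijk in auto)
        then have s: "r i + r j + r k \<le> ?n" using ijk rK' by (simp add: add.assoc)
        have "r i \<noteq> 0" "r j \<noteq> 0" "r k \<noteq> 0" using ijk by (auto simp: K'_def)
        then have "(2 * r i < ?n \<and> 2 * r j < ?n) \<or> (2 * r i < ?n \<and> 2 * r k < ?n) \<or> (2 * r j < ?n \<and> 2 * r k < ?n)"
          using s by linarith
        then show ?thesis using ijk by blast
      qed
      then obtain i j where "i \<in> K'" "j \<in> K'" "i \<noteq> j" "2 * r i < ?n" "2 * r j < ?n" by blast
      then show ?thesis using small[of i] small[of j] EK2[of i j] by linarith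
    next
      case 2
      have "\<exists>i j. i \<noteq> j \<and> K' = {i, j} \<and> r i \<le> r j"
      proof -
        obtain i j where "K' = {i, j}" "i \<noteq> j" using 2 by (auto simp: card_2_iff)
        then show ?thesis by (metis insert_commute nat_le_linear)
      qed
      then obtain i j where ij: "i \<noteq> j" "K' = {i, j}" "r i \<le> r j" by blast
      have rij: "r i + r j = ?n" using rK' ij by simp
      have ri0: "r i \<noteq> 0" using ij by (auto simp: K'_def)
      have Mj: "M j = r i" using rij Mn[of j] by (simp add: r_def)
      show ?thesis
      proof (cases "2 * r i = ?n")
        case True
        have half: "2 * M k = ?n" if "k \<in> K'" for k
          using that ij rij True Mn[of k] by (auto simp: r_def)
        show ?thesis
        proof (cases "?n \<ge> 4")
          case True
          have ev: "even ?n" using half[of i] ij by (metis dvd_triv_left insertI1)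
          have K'eq: "{j\<in>K. card (range (f j)) \<noteq> 1} = K'" using const by (auto simp: K'_def)
          have "\<exists>k\<in>K'. \<not> (card (range (f k)) = 2 \<and> (\<forall>x\<in>range (f k). 2 * mult_in UNIV (f k) x = ?n))"
          proof (rule ccontr)
            assume *: "\<not> ?thesis"
            show False
            proof (rule notA[OF True ev])
              show "card {j\<in>K. card (range (f j)) \<noteq> 1} = 2" using 2 K'eq by simp
              fix j assume "j \<in> K" "card (range (f j)) \<noteq> 1"
              then have "j \<in> K'" using K'eq by blast
              then show "card (range (f j)) = 2 \<and> (\<forall>x\<in>range (f j). 2 * mult_in UNIV (f j) x = ?n)"
                using * by blast
            qed
          qed
          then obtain k where k: "k \<in> K'"
            "\<not> (card (range (f k)) = 2 \<and> (\<forall>x\<in>range (f k). 2 * mult_in UNIV (f k) x = ?n))"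
            by blast
          \<comment> \<open>The other values share \<open>n / 2\<close> indices. A single other value is excluded by the choice of
          \<open>k\<close>, so there are two of multiplicity less than \<open>M k\<close>.\<close>
          define V where "V = range (f k) - {x k}"
          have sV: "(\<Sum>y\<in>V. mult_in UNIV (f k) y) = M k"
            using sum.remove[of "range (f k)" "x k" "mult_in UNIV (f k)"] x(1)[of k]
              sum_mult_in[of UNIV "f k"] half[OF k(1)] by (simp add: V_def M_def)
          have cV: "card (range (f k)) = Suc (card V)"
            using x(1)[of k] unfolding V_def by (metis card_Suc_Diff1 finite finite_imageI)
          have "V \<noteq> {}" using sV Mpos[of k] by auto
          then have "card V \<noteq> 0" by (simp add: V_def)
          moreover have "card V \<noteq> 1"
          proof
            assume "card V = 1"
            then obtain y where y: "V = {y}" by (auto simp: card_1_singleton_iff)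
            then have "mult_in UNIV (f k) y = M k" using sV by simp
            moreover have "range (f k) = {x k, y}" using y x(1)[of k] unfolding V_def by blast
            ultimately show False using k(2) half[OF k(1)] cV y by (auto simp: M_def)
          qed
          ultimately have "2 \<le> card V" by linarith
          then obtain S where "S \<subseteq> V" "card S = 2" using obtain_subset_with_card_n by metis
          then obtain y z where yz: "y \<in> V" "z \<in> V" "y \<noteq> z" by (auto simp: card_2_iff)
          have "(\<Sum>y\<in>{y,z}. mult_in UNIV (f k) y) \<le> M k"
            unfolding sV[symmetric] by (rule sum_mono2) (use yz in \<open>auto simp: V_def\<close>)
          moreover have "mult_in UNIV (f k) y \<noteq> 0" "mult_in UNIV (f k) z \<noteq> 0"
            using yz by (auto simp: mult_in_eq_0 V_def)
          ultimately have "mult_in UNIV (f k) y < M k" "mult_in UNIV (f k) z < M k"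
            using yz(3) by auto
          then have "2 * (M k - 1) \<le> E k"
            unfolding E_def using yz by (intro excess_double[of y _ _ z]) (auto simp: V_def)
          then show ?thesis using half[OF k(1)] EK1[OF k(1)] by linarith
        next
          case False
          have "2 * M i = ?n" using half[of i] ij by simp
          then have "?n - 2 = 0" using False n2 by presburger
          then show ?thesis by (simp only: le0)
        qed
      next
        case False
        then have lt: "2 * r i < ?n" using rij ij(3) by linarith
        show ?thesis
        proof (cases "?n = 2 * r i + 1")
          case True
          have Ei: "r i \<le> E i" using dom[of i] True by simp
          \<comment> \<open>All multiplicities of \<open>f j\<close> equal to \<open>M j = r i\<close> would make \<open>r i\<close> a divisor of
          \<open>n = 2 * r i + 1\<close>, hence equal to \<open>1\<close>, where the claim is trivial.\<close>
          have "r i - 1 \<le> E j"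
          proof (cases "\<exists>y\<in>range (f j). mult_in UNIV (f j) y < M j")
            case True
            then show ?thesis using excess_single[of _ "f j" "M j"] by (auto simp: E_def Mj)
          next
            case False
            then have "\<forall>y\<in>range (f j). mult_in UNIV (f j) y = M j"
              using x(2) by (auto simp: M_def not_less intro: le_antisym)
            then have "(\<Sum>y\<in>range (f j). mult_in UNIV (f j) y) = (\<Sum>y\<in>range (f j). r i)"
              by (intro sum.cong) (auto simp: Mj)
            then have "card (range (f j)) * r i = ?n"
              using sum_mult_in[of UNIV "f j"] by simp
            then have "r i dvd 2 * r i + 1" using True by (metis dvd_triv_right)
            then have "r i dvd 1" by (metis dvd_add_right_iff dvd_triv_right)
            then show ?thesis by simp
          qed
          then show ?thesis using Ei EK2[of i j] ij True by simp
        next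
          case False
          have "?n - 2 \<le> r i * (?n - 2 * r i)"
            using ri0 lt False by (intro large_gap) auto
          also have "\<dots> \<le> E i" by (rule dom)
          also have "\<dots> \<le> (\<Sum>j\<in>K. E j)" using EK1[of i] ij by simp
          finally show ?thesis .
        qed
      qed
    qed
    then show ?thesis unfolding total rn by (simp add: power2_eq_square)
  qed
qed

section \<open>Case A as the only obstruction to perturbing\<close>

lemma eigenbasis_order_mult:
  "eigenbasis A Q d \<Longrightarrow> order c (charpoly A) = mult_in UNIV d c"
  by (simp add: eigenbasis_order mult_in_def)

lemma card_range_1_iff: "card (range f) = 1 \<longleftrightarrow> (\<exists>c. \<forall>k. f k = c)"
  by (auto simp: card_1_singleton_iff)

lemma case_A_I:
  fixes X :: "nat \<Rightarrow> complex^'n^'n"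
  assumes eb: "\<And>j. j \<in> {2..p+1} \<Longrightarrow> eigenbasis (X j) (Q j) (f j)"
    and n: "CARD('n) \<ge> 4" "even CARD('n)"
    and two: "card {j\<in>{2..p+1}. card (range (f j)) \<noteq> 1} = 2"
    and halves: "\<And>j. j \<in> {2..p+1} \<Longrightarrow> card (range (f j)) \<noteq> 1 \<Longrightarrow>
      card (range (f j)) = 2 \<and> (\<forall>x\<in>range (f j). 2 * mult_in UNIV (f j) x = CARD('n))"
  shows "case_A p X"
proof -
  have sc: "scalar_matrix (X j) \<longleftrightarrow> card (range (f j)) = 1" if "j \<in> {2..p+1}" for j
    unfolding card_range_1_iff using eb[OF that] by (rule eigenbasis_scalar_iff)
  have "{j\<in>{2..p+1}. \<not> scalar_matrix (X j)} = {j\<in>{2..p+1}. card (range (f j)) \<noteq> 1}"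
    using sc by blast
  moreover have "multiplicity_vector (X j) = {#CARD('n) div 2, CARD('n) div 2#}"
    if j: "j \<in> {2..p+1}" "\<not> scalar_matrix (X j)" for j
  proof -
    have h: "card (range (f j)) = 2" "\<And>x. x \<in> range (f j) \<Longrightarrow> 2 * mult_in UNIV (f j) x = CARD('n)"
      using halves[OF j(1)] sc[OF j(1)] j(2) by auto
    then obtain x y where xy: "range (f j) = {x, y}" "x \<noteq> y" by (auto simp: card_2_iff)
    have "mult_in UNIV (f j) x = CARD('n) div 2" "mult_in UNIV (f j) y = CARD('n) div 2"
      using h(2)[of x] h(2)[of y] xy by auto
    then show ?thesis
      using xy by (simp add: multiplicity_vector_def eigenbasis_eigenvalues[OF eb[OF j(1)]]
          eigenbasis_order_mult[OF eb[OF j(1)]])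
  qed
  ultimately show ?thesis unfolding case_A_def using n two by simp
qed

lemma case_A_conj:
  fixes X Y :: "nat \<Rightarrow> complex^'n^'n"
  assumes "\<And>j. j \<in> {2..p+1} \<Longrightarrow> Y j \<in> conj_class (X j)"
  shows "case_A p Y \<longleftrightarrow> case_A p X"
proof -
  have s: "scalar_matrix (Y j) \<longleftrightarrow> scalar_matrix (X j)"
    and m: "multiplicity_vector (Y j) = multiplicity_vector (X j)" if "j \<in> {2..p+1}" for j
    using scalar_matrix_conj[OF assms[OF that]] charpoly_conj[OF assms[OF that]]
      eigenvalues_conj[OF assms[OF that]] by (simp_all add: multiplicity_vector_def)
  have "{j\<in>{2..p+1}. \<not> scalar_matrix (Y j)} = {j\<in>{2..p+1}. \<not> scalar_matrix (X j)}"
    using s by blast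
  then show ?thesis using s m unfolding case_A_def by auto
qed

text \<open>There are enough unknowns for a perturbation, because otherwise the count of pairs would be
  tight and \<open>tight_count_halves\<close>, applied to \<open>C\<close> and to its complement, would give Case A.\<close>

lemma corner_perturbation:
  fixes X :: "nat \<Rightarrow> complex^'n^'n"
  assumes dg: "\<And>j. j \<in> {2..p+1} \<Longrightarrow> diagonalizable (X j)"
    and bd: "\<And>j. j \<in> {2..p+1} \<Longrightarrow> block_diag C (X j)"
    and C: "C \<noteq> {}" "C \<noteq> UNIV"
    and ncev: "no_common_eigenvector {2..p+1} X"
    and notA: "\<not> case_A p X"
    and LR: "\<And>j. j \<in> {2..p+1} \<Longrightarrow> block_diag C (L j)" "\<And>j. j \<in> {2..p+1} \<Longrightarrow> block_diag C (R j)"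
  shows "\<exists>T. (\<exists>j\<in>{2..p+1}. T j \<noteq> 0) \<and> (\<forall>j\<in>{2..p+1}. corner C (T j)) \<and>
    (\<Sum>j\<in>{2..p+1}. L j ** T j ** R j) = 0 \<and>
    (\<forall>j\<in>{2..p+1}. \<forall>t::real. X j + t *\<^sub>R T j \<in> conj_class (X j))"
proof -
  let ?K = "{2..p+1}"
  have "\<forall>j. \<exists>Q d. j \<in> ?K \<longrightarrow> eigenbasis (X j) Q d \<and> block_diag C Q"
    using adapted_eigenbasis[OF dg bd] by blast
  then obtain Q f where Qf: "\<And>j. j \<in> ?K \<Longrightarrow> eigenbasis (X j) (Q j) (f j)"
    "\<And>j. j \<in> ?K \<Longrightarrow> block_diag C (Q j)" by metis
  have Qf': "block_diag (- C) (Q j)" if "j \<in> ?K" for j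
    using Qf(2)[OF that] by (auto simp: block_diag_nth)
  have betaC: "card C \<le> (\<Sum>j\<in>?K. card {a\<in>C. f j a \<noteq> \<mu> j})" for \<mu>
    by (rule no_common_eigenvector_count[OF _ ncev Qf]) auto
  have betaD: "card (- C) \<le> (\<Sum>j\<in>?K. card {a\<in>- C. f j a \<noteq> \<mu> j})" for \<mu>
    by (rule no_common_eigenvector_count[OF _ ncev Qf(1) Qf']) auto
  have "card C * card (- C) < (\<Sum>j\<in>?K. card {(a, b). a \<in> C \<and> b \<notin> C \<and> f j a \<noteq> f j b})"
  proof (rule ccontr)
    assume "\<not> ?thesis"
    then have tight: "(\<Sum>j\<in>?K. card {(a, b). a \<in> C \<and> b \<in> - C \<and> f j a \<noteq> f j b}) \<le> card C * card (- C)"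
      by simp
    have tight': "(\<Sum>j\<in>?K. card {(a, b). a \<in> - C \<and> b \<in> C \<and> f j a \<noteq> f j b}) \<le> card (- C) * card C"
    proof -
      have "card {(a, b). a \<in> - C \<and> b \<in> C \<and> f j a \<noteq> f j b} = card {(a, b). a \<in> C \<and> b \<in> - C \<and> f j a \<noteq> f j b}" for j
        by (rule bij_betw_same_card[of prod.swap]) (auto simp: bij_betw_def inj_on_def image_iff)
      then show ?thesis using tight by (simp add: mult.commute)
    qed
    have D: "- C \<noteq> {}" using C by auto
    note hC = tight_count_halves[OF finite_atLeastAtMost finite finite C(1) D betaC betaD tight]
    note hD = tight_count_halves[OF finite_atLeastAtMost finite finite D C(1) betaD betaC tight']
    have rg: "range (f j) = f j ` C" "f j ` (- C) = f j ` C" if "j \<in> ?K" for j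
    proof -
      show "f j ` (- C) = f j ` C" using hC(1)[OF that] by simp
      moreover have "range (f j) = f j ` C \<union> f j ` (- C)" by (metis image_Un Compl_partition)
      ultimately show "range (f j) = f j ` C" by simp
    qed
    have mult: "mult_in UNIV (f j) x = mult_in C (f j) x + mult_in (- C) (f j) x" for j x
    proof -
      have "{a \<in> UNIV. f j a = x} = {a \<in> C. f j a = x} \<union> {a \<in> - C. f j a = x}" by auto
      moreover have "card ({a \<in> C. f j a = x} \<union> {a \<in> - C. f j a = x}) = card {a \<in> C. f j a = x} + card {a \<in> - C. f j a = x}"
        by (rule card_Un_disjoint) auto
      ultimately show ?thesis by (simp add: mult_in_def)
    qed
    have cards: "card C + card (- C) = CARD('n)"
      by (metis card_Un_disjoint finite Compl_partition Compl_disjoint)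
    have eqs: "{j\<in>?K. card (range (f j)) \<noteq> 1} = {j\<in>?K. card (f j ` C) \<noteq> 1}"
      using rg by auto
    have two: "card {j\<in>?K. card (range (f j)) \<noteq> 1} = 2"
      unfolding eqs using hC(2) by simp
    have halves: "card (range (f j)) = 2 \<and> (\<forall>x\<in>range (f j). 2 * mult_in UNIV (f j) x = CARD('n))"
      and evenC: "even (card C)" and evenD: "even (card (- C))"
      if "j \<in> ?K" "card (range (f j)) \<noteq> 1" for j
    proof -
      have c: "card (f j ` C) = 2" "\<And>x. x \<in> f j ` C \<Longrightarrow> 2 * mult_in C (f j) x = card C"
        using hC(3)[OF that(1)] that(2) unfolding rg(1)[OF that(1)] by blast+
      have d: "\<And>x. x \<in> f j ` C \<Longrightarrow> 2 * mult_in (- C) (f j) x = card (- C)"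
        using hD(3)[OF that(1)] that(2) unfolding rg(1)[OF that(1)] rg(2)[OF that(1)] by blast
      have "2 * mult_in UNIV (f j) x = CARD('n)" if "x \<in> f j ` C" for x
        using c(2)[OF that] d[OF that] cards by (simp add: mult)
      then show "card (range (f j)) = 2 \<and> (\<forall>x\<in>range (f j). 2 * mult_in UNIV (f j) x = CARD('n))"
        using c(1) rg[OF that(1)] by simp
      obtain x where "x \<in> f j ` C" using C by auto
      then show "even (card C)" "even (card (- C))" using c(2) d by (metis dvd_triv_left)+
    qed
    obtain j where j: "j \<in> ?K" "card (range (f j)) \<noteq> 1"
    proof -
      have "{j\<in>?K. card (range (f j)) \<noteq> 1} \<noteq> {}" using two by (metis card.empty zero_neq_numeral)
      then show ?thesis using that by blast
    qed
    have "card C \<noteq> 0" "card (- C) \<noteq> 0" using C D by auto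
    then have "4 \<le> CARD('n)" "even CARD('n)"
      using evenC[OF j] evenD[OF j] cards by presburger+
    then have "case_A p X" using Qf(1) two halves by (intro case_A_I) auto
    then show False using notA by simp
  qed
  then have count: "card C * card (- C) < (\<Sum>j\<in>?K. card {(a, b). a \<in> C \<and> b \<notin> C \<and> f j a \<noteq> f j b})" .
  show ?thesis
    by (rule extension_exists[where Q = Q and d = f, OF finite_atLeastAtMost]) (erule Qf LR | rule count)+
qed

section \<open>Products over lists of indices\<close>

definition tprod :: "nat list \<Rightarrow> (nat \<Rightarrow> complex^'n^'n) \<Rightarrow> complex^'n^'n" where
  "tprod js X = foldr (\<lambda>j B. X j ** B) js (mat 1)"

lemma tprod_simps [simp]: "tprod [] X = mat 1" "tprod (j # js) X = X j ** tprod js X"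
  by (simp_all add: tprod_def)

lemma tprod_append: "tprod (is @ js) X = tprod is X ** tprod js X"
  by (induction "is") (simp_all add: matrix_mul_assoc)

lemma unit_product_tprod: "unit_product p X \<longleftrightarrow> tprod [1..<p+2] X = mat 1"
  by (simp add: unit_product_def tprod_def)

lemma tprod_cong: "(\<And>j. j \<in> set js \<Longrightarrow> X j = Y j) \<Longrightarrow> tprod js X = tprod js Y"
  by (induction js) auto

lemma tprod_block_diag: "(\<And>j. j \<in> set js \<Longrightarrow> block_diag C (X j)) \<Longrightarrow> block_diag C (tprod js X)"
  by (induction js) (auto intro: block_diag_mult block_diag_mat)

lemma tprod_invertible: "(\<And>j. j \<in> set js \<Longrightarrow> invertible (X j)) \<Longrightarrow> invertible (tprod js X)"
  by (induction js) (auto intro: invertible_mult simp: invertible_def[of "mat 1"] exI[of _ "mat 1"])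

lemma tprod_conj:
  fixes Q :: "complex^'n^'n"
  assumes "invertible Q"
  shows "tprod js (\<lambda>j. Q ** X j ** matrix_inv Q) = Q ** tprod js X ** matrix_inv Q"
proof (induction js)
  case Nil
  then show ?case by (simp add: matrix_inv_mult assms)
next
  case (Cons j js)
  have "tprod (j # js) (\<lambda>j. Q ** X j ** matrix_inv Q)
      = Q ** X j ** matrix_inv Q ** (Q ** tprod js X ** matrix_inv Q)"
    by (simp add: Cons)
  also have "\<dots> = Q ** X j ** (matrix_inv Q ** (Q ** (tprod js X ** matrix_inv Q)))"
    by (simp add: matrix_mul_assoc)
  also have "\<dots> = Q ** tprod (j # js) X ** matrix_inv Q"
    by (simp only: matrix_inv_cancel assms) (simp add: matrix_mul_assoc)
  finally show ?case .
qed

lemma tprod_eigenvector: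
  assumes "\<And>j. j \<in> set js \<Longrightarrow> X j *v v = c j *s v"
  shows "tprod js X *v v = prod_list (map c js) *s v"
  using assms
proof (induction js)
  case (Cons j js)
  then show ?case
    by (simp add: vector_smult_assoc vector_scalar_commute mult.commute flip: matrix_vector_mul_assoc)
qed simp

text \<open>The product is multilinear, and a term with two factors \<open>T j\<close> vanishes because between them only
  block diagonal factors occur. So the product depends affinely on \<open>T\<close>.\<close>

lemma tprod_corner_expansion:
  assumes "distinct js" "\<And>j. j \<in> set js \<Longrightarrow> block_diag C (X j)"
  shows "\<exists>L R. (\<forall>j\<in>set js. block_diag C (L j) \<and> block_diag C (R j)) \<and>
    (\<forall>T. (\<forall>j\<in>set js. corner C (T j)) \<longrightarrow>
       tprod js (\<lambda>j. X j + T j) = tprod js X + (\<Sum>j\<in>set js. L j ** T j ** R j))"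
  using assms
proof (induction js)
  case (Cons i js)
  then obtain L R where LR: "\<And>j. j \<in> set js \<Longrightarrow> block_diag C (L j)" "\<And>j. j \<in> set js \<Longrightarrow> block_diag C (R j)"
    "\<And>T. \<forall>j\<in>set js. corner C (T j) \<Longrightarrow>
       tprod js (\<lambda>j. X j + T j) = tprod js X + (\<Sum>j\<in>set js. L j ** T j ** R j)"
    by auto
  define L' where "L' j = (if j = i then mat 1 else X i ** L j)" for j
  define R' where "R' j = (if j = i then tprod js X else R j)" for j
  have "tprod (i # js) (\<lambda>j. X j + T j) = tprod (i # js) X + (\<Sum>j\<in>set (i # js). L' j ** T j ** R' j)"
    if T: "\<forall>j\<in>set (i # js). corner C (T j)" for T
  proof -
    define S where "S = (\<Sum>j\<in>set js. L j ** T j ** R j)"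
    have "T i ** (L j ** T j ** R j) = 0" if "j \<in> set js" for j
      by (rule corner_mult_zero[of C, OF _ corner_mult_right[OF _ corner_mult_left]]) (use T LR that in auto)
    then have TS: "T i ** S = 0" by (simp add: S_def matrix_mul_sum_right)
    have "X i ** S = (\<Sum>j\<in>set js. L' j ** T j ** R' j)"
      unfolding S_def matrix_mul_sum_right
      by (rule sum.cong) (use Cons.prems in \<open>auto simp: L'_def R'_def matrix_mul_assoc\<close>)
    then have "(\<Sum>j\<in>set (i # js). L' j ** T j ** R' j) = T i ** tprod js X + X i ** S"
      using Cons.prems by (simp add: L'_def R'_def)
    then show ?thesis
      using LR(3)[of T] T TS by (simp add: matrix_mul_add_left matrix_add_ldistrib flip: S_def)
  qed
  moreover have "\<forall>j\<in>set (i # js). block_diag C (L' j) \<and> block_diag C (R' j)"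
    using LR Cons.prems(2) by (auto simp: L'_def R'_def intro!: block_diag_mult block_diag_mat tprod_block_diag)
  ultimately show ?case by blast
qed auto

section \<open>Deforming a decomposable tuple\<close>

text \<open>A matrix commuting with \<open>X 1\<close> is diagonal, the diagonal entries of \<open>X 1\<close> being distinct. If it
  commutes with the whole tuple, its eigenspaces are invariant coordinate subspaces.\<close>

lemma nontrivial_centralizer_blocks:
  fixes X :: "nat \<Rightarrow> complex^'n^'n"
  assumes X1: "X 1 = diag d" "inj d" and nt: "\<not> trivial_centralizer p X"
  shows "\<exists>C. C \<noteq> {} \<and> C \<noteq> UNIV \<and> (\<forall>j\<in>{1..p+1}. block_diag C (X j))"
proof -
  obtain B :: "complex^'n^'n" where B: "\<And>j. j \<in> {1..p+1} \<Longrightarrow> B ** X j = X j ** B" "\<not> scalar_matrix B"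
    using nt unfolding trivial_centralizer_def by blast
  have off: "B $ i $ k = 0" if "i \<noteq> k" for i k
  proof -
    have "B ** diag d = diag d ** B" using B(1)[of 1] X1 by simp
    then have "B $ i $ k * d k = d i * B $ i $ k" by (metis diag_mul_left diag_mul_right)
    moreover have "d i \<noteq> d k" using X1(2) that by (auto dest: injD)
    ultimately show ?thesis by (simp add: mult.commute)
  qed
  define b where "b i = B $ i $ i" for i
  have Bb: "B = diag b" using off by (auto simp: vec_eq_iff diag_nth b_def)
  obtain i0 :: 'n where True by simp
  define C where "C = {i. b i = b i0}"
  have "C \<noteq> {}" by (auto simp: C_def)
  moreover have "C \<noteq> UNIV"
  proof
    assume "C = UNIV"
    then have "b i = b i0" for i by (auto simp: C_def)
    then have "B = mat (b i0)" by (simp add: Bb vec_eq_iff diag_nth mat_def)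
    then show False using B(2) by (auto simp: scalar_matrix_def)
  qed
  moreover have "block_diag C (X j)" if "j \<in> {1..p+1}" for j
    unfolding block_diag_nth
  proof (intro allI impI)
    fix i k assume nz: "X j $ i $ k \<noteq> 0"
    have "diag b ** X j = X j ** diag b" using B(1)[OF that] by (simp add: Bb)
    then have "b i * X j $ i $ k = X j $ i $ k * b k" by (metis diag_mul_left diag_mul_right)
    then have "b i = b k" using nz by simp
    then show "i \<in> C \<longleftrightarrow> k \<in> C" by (simp add: C_def)
  qed
  ultimately show ?thesis by blast
qed

text \<open>It grows with every perturbation into an off-diagonal block that is zero for the whole tuple, and
  so measures the progress of the deformation.\<close>

definition support :: "nat \<Rightarrow> (nat \<Rightarrow> complex^'n^'n) \<Rightarrow> ('n \<times> 'n) set" where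
  "support p X = {(i, k). \<exists>j\<in>{1..p+1}. X j $ i $ k \<noteq> 0}"

text \<open>The common feature of the sum and the product condition: for a block diagonal tuple, adding
  corner matrices \<open>T j\<close> to all matrices except the first preserves the condition \<open>P\<close> as soon as one
  linear equation holds for the \<open>T j\<close>.\<close>

definition corner_linear :: "nat \<Rightarrow> ((nat \<Rightarrow> complex^'n^'n) \<Rightarrow> bool) \<Rightarrow> bool" where
  "corner_linear p P \<longleftrightarrow> (\<forall>Y C. P Y \<and> (\<forall>j\<in>{1..p+1}. block_diag C (Y j)) \<longrightarrow>
     (\<exists>L R. (\<forall>j\<in>{2..p+1}. block_diag C (L j) \<and> block_diag C (R j)) \<and>
       (\<forall>T. (\<forall>j\<in>{2..p+1}. corner C (T j)) \<and> (\<Sum>j\<in>{2..p+1}. L j ** T j ** R j) = 0 \<longrightarrow>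
          P (\<lambda>j. if j \<in> {2..p+1} then Y j + T j else Y j))))"

text \<open>Each step merges two complementary blocks by a small perturbation in one corner. The matrix
  \<open>X 1\<close> remains the same diagonal matrix, the other ones stay in their conjugacy classes, and the
  support grows strictly; half of \<open>\<epsilon>\<close> is reserved for the later steps.\<close>

lemma deform_diagonal:
  fixes X :: "nat \<Rightarrow> complex^'n^'n"
  assumes X1: "X 1 = diag d" "inj d"
    and dg: "\<And>j. j \<in> {2..p+1} \<Longrightarrow> diagonalizable (X j)"
    and notA: "\<not> case_A p X"
    and ncev: "\<And>Y. P Y \<Longrightarrow> (\<And>j. j \<in> {1..p+1} \<Longrightarrow> Y j \<in> conj_class (X j)) \<Longrightarrow> no_common_eigenvector {2..p+1} Y"
    and lin: "corner_linear p P"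
    and PX: "P X" and eps: "\<epsilon> > 0"
  shows "\<exists>Y. (\<forall>j\<in>{1..p+1}. Y j \<in> conj_class (X j) \<and> dist (Y j) (X j) < \<epsilon>) \<and> P Y \<and> trivial_centralizer p Y"
  using assms
proof (induction "CARD('n \<times> 'n) - card (support p X)" arbitrary: X \<epsilon> rule: less_induct)
  case less
  note X1 = less.prems(1,2) and dg = less.prems(3) and notA = less.prems(4) and ncev_all = less.prems(5)
    and PX = less.prems(7) and eps = less.prems(8)
  show ?case
  proof (cases "trivial_centralizer p X")
    case True
    then show ?thesis using PX eps by (intro exI[of _ X]) (auto simp: conj_class_refl)
  next
    case False
    obtain C where C: "C \<noteq> {}" "C \<noteq> UNIV" "\<And>j. j \<in> {1..p+1} \<Longrightarrow> block_diag C (X j)"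
      using nontrivial_centralizer_blocks[of X d p] X1 False by blast
    have bd: "block_diag C (X j)" if "j \<in> {2..p+1}" for j using C(3) that by simp
    have "P X \<and> (\<forall>j\<in>{1..p+1}. block_diag C (X j))" using PX C(3) by blast
    from lin[unfolded corner_linear_def, THEN spec, THEN spec, THEN mp, OF this]
    obtain L R where L: "\<forall>j\<in>{2..p+1}. block_diag C (L j) \<and> block_diag C (R j)"
      and R: "\<forall>T. (\<forall>j\<in>{2..p+1}. corner C (T j)) \<and> (\<Sum>j\<in>{2..p+1}. L j ** T j ** R j) = 0 \<longrightarrow>
          P (\<lambda>j. if j \<in> {2..p+1} then X j + T j else X j)"
      by (elim exE conjE)
    have LR: "\<And>j. j \<in> {2..p+1} \<Longrightarrow> block_diag C (L j)" "\<And>j. j \<in> {2..p+1} \<Longrightarrow> block_diag C (R j)"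
      using L by simp_all
    have LR3: "P (\<lambda>j. if j \<in> {2..p+1} then X j + T j else X j)"
      if "\<forall>j\<in>{2..p+1}. corner C (T j)" "(\<Sum>j\<in>{2..p+1}. L j ** T j ** R j) = 0" for T
      by (rule R[THEN spec, THEN mp]) (rule conjI[OF that])
    have ncev: "no_common_eigenvector {2..p+1} X" using ncev_all[OF PX] conj_class_refl by blast
    have "\<exists>T. (\<exists>j\<in>{2..p+1}. T j \<noteq> 0) \<and> (\<forall>j\<in>{2..p+1}. corner C (T j)) \<and>
      (\<Sum>j\<in>{2..p+1}. L j ** T j ** R j) = 0 \<and>
      (\<forall>j\<in>{2..p+1}. \<forall>t::real. X j + t *\<^sub>R T j \<in> conj_class (X j))"
      by (rule corner_perturbation[of p X, OF _ _ C(1,2) ncev notA]) (erule dg bd LR)+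
    then obtain T where T: "\<exists>j\<in>{2..p+1}. T j \<noteq> 0" "\<And>j. j \<in> {2..p+1} \<Longrightarrow> corner C (T j)"
      "(\<Sum>j\<in>{2..p+1}. L j ** T j ** R j) = 0"
      "\<And>j t. j \<in> {2..p+1} \<Longrightarrow> X j + t *\<^sub>R T j \<in> conj_class (X j)"
      by blast
    \<comment> \<open>The step size is chosen so that no matrix moves by \<open>\<epsilon> / 2\<close>; the summand \<open>1\<close> keeps \<open>s\<close> positive.\<close>
    define s where "s = 1 + (\<Sum>j\<in>{2..p+1}. norm (T j))"
    have s: "s > 0" unfolding s_def by (intro add_pos_nonneg sum_nonneg) auto
    define t where "t = \<epsilon> / 2 / s"
    have t: "t > 0" using s eps by (simp add: t_def)
    define Y where "Y j = (if j \<in> {2..p+1} then X j + t *\<^sub>R T j else X j)" for j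
    have YC: "Y j \<in> conj_class (X j)" for j
      by (simp add: Y_def T(4) conj_class_refl)
    have Y1: "Y 1 = diag d" using X1 by (simp add: Y_def)
    have dist: "dist (Y j) (X j) < \<epsilon> / 2" for j
    proof (cases "j \<in> {2..p+1}")
      case True
      have "norm (T j) \<le> (\<Sum>j\<in>{2..p+1}. norm (T j))" using True by (intro member_le_sum) auto
      then have "t * norm (T j) < t * s" using t by (intro mult_strict_left_mono) (auto simp: s_def)
      moreover have "t * s = \<epsilon> / 2" using s by (simp add: t_def)
      moreover have "dist (Y j) (X j) = t * norm (T j)" using True t by (simp add: Y_def dist_norm)
      ultimately show ?thesis by simp
    next
      case False
      then have "Y j = X j" unfolding Y_def by (rule if_not_P)
      then show ?thesis using eps by simp
    qed
    have "\<forall>j\<in>{2..p+1}. corner C (t *\<^sub>R T j)"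
    proof
      fix j assume "j \<in> {2..p+1}"
      from T(2)[OF this] show "corner C (t *\<^sub>R T j)" by (auto simp: corner_nth)
    qed
    moreover have "(\<Sum>j\<in>{2..p+1}. L j ** (t *\<^sub>R T j) ** R j) = 0"
      using T(3) by (simp add: matrix_scalar_ac flip: scalar_matrix_assoc scaleR_sum_right)
    ultimately have PY: "P Y" unfolding Y_def[abs_def] by (rule LR3)
    have bigger: "support p X \<subset> support p Y"
    proof -
      have "(i, k) \<in> support p Y" if "(i, k) \<in> support p X" for i k
      proof -
        obtain j where j: "j \<in> {1..p+1}" "X j $ i $ k \<noteq> 0" using \<open>(i, k) \<in> support p X\<close> by (auto simp: support_def)
        then have "i \<in> C \<longleftrightarrow> k \<in> C" using C(3)[OF j(1)] by (auto simp: block_diag_nth)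
        then have "T j $ i $ k = 0" if "j \<in> {2..p+1}" using T(2)[OF that] by (auto simp: corner_nth)
        then have "Y j $ i $ k = X j $ i $ k" by (simp add: Y_def)
        then show ?thesis using j by (auto simp: support_def intro!: bexI[of _ j])
      qed
      moreover obtain j i k where jik: "j \<in> {2..p+1}" "T j $ i $ k \<noteq> 0"
        using T(1) by (auto simp: vec_eq_iff)
      then have ik: "i \<in> C" "k \<notin> C" using T(2)[OF jik(1)] by (auto simp: corner_nth)
      then have X0: "X j' $ i $ k = 0" if "j' \<in> {1..p+1}" for j'
        using C(3)[OF that] by (auto simp: block_diag_nth)
      then have "(i, k) \<notin> support p X" by (auto simp: support_def)
      moreover have "Y j $ i $ k \<noteq> 0" using X0[of j] jik t by (simp add: Y_def)
      then have "(i, k) \<in> support p Y" using jik(1) by (auto simp: support_def)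
      ultimately show ?thesis by auto
    qed
    then have "card (support p X) < card (support p Y)" by (intro psubset_card_mono) auto
    moreover have "card (support p Y) \<le> CARD('n \<times> 'n)" by (intro card_mono) auto
    ultimately have meas: "CARD('n \<times> 'n) - card (support p Y) < CARD('n \<times> 'n) - card (support p X)"
      by linarith
    have "\<exists>Z. (\<forall>j\<in>{1..p+1}. Z j \<in> conj_class (Y j) \<and> dist (Z j) (Y j) < \<epsilon> / 2) \<and> P Z \<and> trivial_centralizer p Z"
    proof (rule less.hyps[OF meas Y1 X1(2)])
      show "diagonalizable (Y j)" if "j \<in> {2..p+1}" for j
        using dg[OF that] YC by (rule diagonalizable_conj)
      show "\<not> case_A p Y" using notA case_A_conj[of p Y X] YC by blast
      show "no_common_eigenvector {2..p+1} Z"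
        if "P Z" "\<And>j. j \<in> {1..p+1} \<Longrightarrow> Z j \<in> conj_class (Y j)" for Z
        using ncev_all[OF that(1)] that(2) YC conj_class_trans by blast
    qed (use lin PY eps in auto)
    then obtain Z where Z: "\<And>j. j \<in> {1..p+1} \<Longrightarrow> Z j \<in> conj_class (Y j)"
      "\<And>j. j \<in> {1..p+1} \<Longrightarrow> dist (Z j) (Y j) < \<epsilon> / 2" "P Z" "trivial_centralizer p Z" by blast
    have "Z j \<in> conj_class (X j) \<and> dist (Z j) (X j) < \<epsilon>" if "j \<in> {1..p+1}" for j
      using conj_class_trans[OF YC Z(1)[OF that]] dist_triangle_half_l[of "Y j" "X j" \<epsilon> "Z j"]
        Z(2)[OF that] dist[of j] by (metis dist_commute dist_triangle_half_r)
    then show ?thesis using Z(3,4) by blast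
  qed
qed

section \<open>A lower bound for the dimension of a conjugacy class\<close>

lemma bounded_bilinear_matrix_mul:
  "bounded_bilinear ((**) :: complex^'n^'n \<Rightarrow> complex^'n^'n \<Rightarrow> complex^'n^'n)"
  unfolding bilinear_conv_bounded_bilinear[symmetric] bilinear_def
  by (auto intro!: linearI simp: matrix_ring_simps vec_eq_iff matrix_mul_nth scaleR_sum_right)

lemmas matrix_mul_has_derivative [derivative_intros] =
  bounded_bilinear.FDERIV[OF bounded_bilinear_matrix_mul]

lemmas matrix_mul_continuous_on [continuous_intros] =
  bounded_bilinear.continuous_on[OF bounded_bilinear_matrix_mul]

lemma continuous_on_det_entries:
  fixes f :: "'a::topological_space \<Rightarrow> complex^'n^'n"
  assumes "\<And>i k. continuous_on S (\<lambda>x. f x $ i $ k)"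
  shows "continuous_on S (\<lambda>x. det (f x))"
  unfolding det_def by (intro continuous_intros assms)

lemma open_invertible: "open {A :: complex^'n^'n. invertible A}"
proof -
  have "open {A :: complex^'n^'n. det A \<noteq> 0}"
    by (intro open_Collect_neq continuous_on_det_entries continuous_intros)
  then show ?thesis by (simp add: invertible_det_nz)
qed

text \<open>Cramer's rule, from which continuity of the inverse is visible.\<close>

lemma matrix_inv_nth:
  fixes A :: "complex^'n^'n"
  assumes "invertible A"
  shows "matrix_inv A $ i $ k = det (\<chi> p q. if q = i then (if p = k then 1 else 0) else A $ p $ q) / det A"
proof -
  have "A *v (matrix_inv A *v axis k 1) = axis k 1" by (simp add: vec_coords assms)
  moreover have "det A \<noteq> 0" using assms by (simp only: invertible_det_nz simp_thms)
  ultimately have "matrix_inv A *v axis k 1 = (\<chi> i. det (\<chi> p q. if q = i then axis k 1 $ p else A $ p $ q) / det A)"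
    using cramer[THEN iffD1] by blast
  then have "(matrix_inv A *v axis k 1) $ i = det (\<chi> p q. if q = i then axis k 1 $ p else A $ p $ q) / det A"
    by simp
  moreover have "(matrix_inv A *v axis k 1) $ i = matrix_inv A $ i $ k"
    by (simp add: matrix_vector_mult_def axis_def if_distrib[of "\<lambda>x. _ * x"] sum.delta' cong: if_cong)
  ultimately show ?thesis by (simp add: axis_def cong: if_cong)
qed

lemma continuous_on_matrix_inv: "continuous_on {A :: complex^'n^'n. invertible A} matrix_inv"
proof -
  have "continuous_on {A :: complex^'n^'n. invertible A}
      (\<lambda>A. \<chi> i k. det (\<chi> p q. if q = i then (if p = k then 1 else 0) else A $ p $ q) / det A)"
  proof (rule continuous_on_vec_lambda, rule continuous_on_vec_lambda, rule continuous_on_divide)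
    fix i k :: 'n
    let ?S = "{A :: complex^'n^'n. invertible A}"
    show "continuous_on ?S (\<lambda>A. det (\<chi> p q. if q = i then (if p = k then 1 else 0) else A $ p $ q))"
    proof (rule continuous_on_det_entries)
      fix p q :: 'n
      show "continuous_on ?S (\<lambda>A. (\<chi> p q. if q = i then (if p = k then 1 else 0) else A $ p $ q) $ p $ q)"
        by (cases "q = i") (simp_all add: continuous_on_component)
    qed
    show "continuous_on ?S det" by (intro continuous_on_det_entries continuous_intros)
  qed (auto simp: invertible_det_nz)
  then show ?thesis
    by (rule continuous_on_eq) (simp add: vec_eq_iff matrix_inv_nth)
qed

text \<open>The error term of the linear approximation is \<open>(A\<^sup>-\<^sup>1 - y\<^sup>-\<^sup>1) (y - A) A\<^sup>-\<^sup>1\<close>, which is of smaller order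
  than \<open>y - A\<close> because the inverse is continuous.\<close>

lemma matrix_inv_has_derivative:
  fixes A :: "complex^'n^'n"
  assumes "invertible A"
  shows "(matrix_inv has_derivative (\<lambda>H. - (matrix_inv A ** H ** matrix_inv A))) (at A)"
proof -
  let ?B = "matrix_inv A"
  note bb = bounded_bilinear_matrix_mul[where 'n = 'n]
  obtain K where K: "K > 0" "\<And>(a :: complex^'n^'n) (b :: complex^'n^'n). norm (a ** b) \<le> norm a * norm b * K"
    using bounded_bilinear.pos_bounded[OF bb] by blast
  obtain e where e: "e > 0" "\<And>y. dist y A < e \<Longrightarrow> invertible y"
    using bspec[OF open_invertible[unfolded open_dist], of A] assms by auto
  have cont: "(matrix_inv \<longlongrightarrow> ?B) (at A)"
    using continuous_on_matrix_inv assms open_invertible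
    using continuous_on_eq_continuous_at[OF open_invertible] by (auto simp: isCont_def)
  show ?thesis
  proof (rule has_derivativeI_sandwich[OF e(1)])
    show "bounded_linear (\<lambda>H. - (?B ** H ** ?B))"
      by (rule bounded_linear_minus[OF bounded_linear_compose[OF
            bounded_bilinear.bounded_linear_left[OF bb] bounded_bilinear.bounded_linear_right[OF bb]]])
    show "((\<lambda>y. norm (?B - matrix_inv y) * K * norm ?B * K) \<longlongrightarrow> 0) (at A)"
      using tendsto_mult_right_zero tendsto_norm_zero[OF LIM_zero[OF cont]]
      by (auto intro!: tendsto_mult_left_zero simp: norm_minus_commute)
    fix y assume y: "y \<noteq> A" "dist y A < e"
    then have inv: "invertible y" by (intro e)
    have "matrix_inv y - ?B - - (?B ** (y - A) ** ?B) = (?B - matrix_inv y) ** (y - A) ** ?B"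
    proof -
      have "?B ** (y - A) ** ?B = ?B ** y ** ?B - ?B"
        by (simp only: matrix_mul_diff_left matrix_mul_diff_right matrix_inv_mult[OF assms] matrix_mul_lid)
      moreover have "matrix_inv y ** (y - A) ** ?B = ?B - matrix_inv y"
        by (simp only: matrix_mul_diff_left matrix_mul_diff_right matrix_inv_mult[OF inv] matrix_mul_lid
            matrix_inv_cancel(3)[OF assms])
      ultimately show ?thesis by (simp add: matrix_mul_diff_left)
    qed
    also have "norm \<dots> \<le> norm ((?B - matrix_inv y) ** (y - A)) * norm ?B * K" by (rule K)
    also have "\<dots> \<le> (norm (?B - matrix_inv y) * norm (y - A) * K) * norm ?B * K"
      using K by (intro mult_right_mono K(2)) auto
    finally show "norm (matrix_inv y - ?B - - (?B ** (y - A) ** ?B)) / norm (y - A)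
        \<le> norm (?B - matrix_inv y) * K * norm ?B * K"
      using y by (simp add: divide_simps mult_ac)
  qed
qed

lemma vec_linear_matrix:
  fixes L :: "complex^'m \<Rightarrow> complex^'m"
  assumes "\<And>x y. L (x + y) = L x + L y" "\<And>c x. L (c *s x) = c *s L x"
  shows "L = (*v) (matrix L)"
proof -
  have "Vector_Spaces.linear (*s) (*s) L"
    
    by unfold_locales (simp_all add: assms algebra_simps vector_add_ldistrib vector_sadd_rdistrib vector_smult_assoc)
  then show ?thesis by (simp add: matrix_works fun_eq_iff)
qed

text \<open>The dimensions of submanifolds are bounded by the dimension of the ambient space, so the maximum
  in the definition of \<open>complex_dimension\<close> is taken over a finite set.\<close>

lemma complex_dimension_ge:
  fixes S G :: "(complex^'m) set"
  assumes "complex_submanifold d G" "G \<noteq> {}" "G \<subseteq> S"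
  shows "d \<le> complex_dimension S"
  unfolding complex_dimension_def
proof (rule Max_ge)
  have "d \<le> CARD('m)" if sub: "complex_submanifold d G" and ne: "G \<noteq> {}" for d and G :: "(complex^'m) set"
  proof -
    obtain x where "x \<in> G" using ne by blast
    then obtain W :: "(complex^'m) set" where "vec.dim W = d"
      using bspec[OF sub[unfolded complex_submanifold_def]] by blast
    then show ?thesis using dim_subset_UNIV_cart_gen[of W] by simp
  qed
  then have "{d. \<exists>G. G \<noteq> {} \<and> G \<subseteq> S \<and> complex_submanifold d G} \<subseteq> {..CARD('m)}"
    by (intro subsetI; elim CollectE exE conjE; simp)
  then show "finite {d. \<exists>G. G \<noteq> {} \<and> G \<subseteq> S \<and> complex_submanifold d G}"
    by (rule finite_subset) simp
qed (use assms in blast)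

text \<open>The inverse function theorem turns \<open>F\<close> into a local biholomorphic map: the inverse of a complex
  linear bijection is complex linear. A single pair of mutually inverse maps serves as chart at every
  point of the image of the subspace.\<close>

lemma complex_submanifold_image:
  fixes F :: "complex^'m \<Rightarrow> complex^'m"
  assumes U: "open U" "z0 \<in> U"
    and der: "\<And>z. z \<in> U \<Longrightarrow> (F has_derivative F' z) (at z)"
    and lin: "\<And>z c h. z \<in> U \<Longrightarrow> F' z (c *s h) = c *s F' z h"
    and cont: "\<And>h. continuous_on U (\<lambda>z. F' z h)"
    and inj: "\<And>h. F' z0 h = 0 \<Longrightarrow> h = 0"
    and W: "vec.subspace W" "vec.dim W = d" "z0 \<in> W"
  shows "\<exists>U'. open U' \<and> z0 \<in> U' \<and> U' \<subseteq> U \<and> complex_submanifold d (F ` (U' \<inter> W))"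
proof -
  define J where "J z = matrix (F' z)" for z
  have J: "F' z = (*v) (J z)" if "z \<in> U" for z
    unfolding J_def
  proof (rule vec_linear_matrix)
    show "F' z (x + y) = F' z x + F' z y" for x y
      using has_derivative_bounded_linear[OF der[OF that]] by (simp add: bounded_linear_def linear_add)
  qed (rule lin[OF that])
  define f' where "f' z = Blinfun (F' z)" for z
  have f': "blinfun_apply (f' z) = F' z" if "z \<in> U" for z
    unfolding f'_def by (rule bounded_linear_Blinfun_apply[OF has_derivative_bounded_linear[OF der[OF that]]])
  have contf': "continuous_on U f'"
    by (rule continuous_on_blinfun_componentwise) (use cont f' in \<open>simp cong: continuous_on_cong\<close>)
  have "inj ((*v) (J z0))"
    by (rule injI) (metis J U(2) eq_iff_diff_eq_0 inj matrix_vector_mult_diff_distrib)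
  then have invJ: "invertible (J z0)"
    using matrix_left_invertible_injective[of "J z0"] by (auto simp: invertible_left_inverse)
  define invf where "invf = Blinfun ((*v) (matrix_inv (J z0)))"
  have "linear ((*v) (matrix_inv (J z0)))" by (rule matrix_vector_mul_linear)
  then have "blinfun_apply invf = (*v) (matrix_inv (J z0))"
    unfolding invf_def by (intro bounded_linear_Blinfun_apply) (simp add: linear_conv_bounded_linear)
  then have invf: "invf o\<^sub>L f' z0 = id_blinfun"
    by (intro blinfun_eqI) (simp add: f' U J vec_coords invJ)
  obtain U' V g g' where IFT: "open U'" "U' \<subseteq> U" "z0 \<in> U'" "open V" "F z0 \<in> V" "homeomorphism U' V F g"
    "\<And>y. y \<in> V \<Longrightarrow> (g has_derivative (g' y)) (at y)"
    "\<And>y. y \<in> V \<Longrightarrow> g' y = inv (blinfun_apply (f' (g y)))"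
    "\<And>y. y \<in> V \<Longrightarrow> bij (blinfun_apply (f' (g y)))"
  proof (rule inverse_function_theorem[OF U(1) _ contf' U(2) invf])
    show "(F has_derivative blinfun_apply (f' x)) (at x)" if "x \<in> U" for x
      using der[OF that] f'[OF that] by simp
  qed (rule that)
  have hom: "F ` U' = V" "g ` V = U'" "\<And>u. u \<in> U' \<Longrightarrow> g (F u) = u" "\<And>v. v \<in> V \<Longrightarrow> F (g v) = v"
    using IFT(6) by (auto simp: homeomorphism_def)
  have holF: "holomorphic_map_on F U'"
    unfolding holomorphic_map_on_def
  proof
    fix z assume "z \<in> U'"
    then have "z \<in> U" using IFT(2) by blast
    then show "\<exists>J. (F has_derivative (*v) J) (at z)" using der[of z] J[of z] by auto
  qed
  have holg: "holomorphic_map_on g V"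
    unfolding holomorphic_map_on_def
  proof
    fix y assume y: "y \<in> V"
    then have gU: "g y \<in> U" using hom(2) IFT(2) by blast
    have b: "bij ((*v) (J (g y)))" using IFT(9)[OF y] by (simp add: f'[OF gU] J[OF gU])
    then have iJ: "invertible (J (g y))" by (simp add: invertible_eq_bij)
    have "g' y = (*v) (matrix_inv (J (g y)))"
    proof
      fix h
      have "g' y h = inv ((*v) (J (g y))) h" by (simp add: IFT(8)[OF y] f'[OF gU] J[OF gU])
      also have "\<dots> = matrix_inv (J (g y)) *v h"
        by (rule inv_f_eq[OF bij_is_inj[OF b]]) (simp add: vec_coords iJ)
      finally show "g' y h = matrix_inv (J (g y)) *v h" .
    qed
    then show "\<exists>J. (g has_derivative (*v) J) (at y)" using IFT(7)[OF y] by auto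
  qed
  define S where "S = F ` (U' \<inter> W)"
  have "complex_submanifold d S"
    unfolding complex_submanifold_def
  proof
    fix x assume "x \<in> S"
    then have "x \<in> F ` (U' \<inter> W)" by (simp add: S_def)
    then have "x \<in> V" using hom(1) by blast
    moreover have "g ` (V \<inter> S) = U' \<inter> W"
    proof -
      have "V \<inter> S = F ` (U' \<inter> W)" using hom(1) unfolding S_def by blast
      then have "g ` (V \<inter> S) = (\<lambda>u. g (F u)) ` (U' \<inter> W)" by (simp add: image_image)
      also have "\<dots> = U' \<inter> W" using hom(3) by auto
      finally show ?thesis .
    qed
    ultimately show "\<exists>U V f g W. open U \<and> open V \<and> x \<in> U \<and>
        holomorphic_map_on f U \<and> holomorphic_map_on g V \<and>
        f ` U = V \<and> g ` V = U \<and> (\<forall>u\<in>U. g (f u) = u) \<and> (\<forall>v\<in>V. f (g v) = v) \<and>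
        vec.subspace W \<and> vec.dim W = d \<and> f ` (U \<inter> S) = V \<inter> W"
      using IFT(1,4) holF holg hom W
      by (intro exI[of _ V] exI[of _ U'] exI[of _ g] exI[of _ F] exI[of _ W]) simp
  qed
  then show ?thesis using IFT(1,2,3) by (auto simp: S_def)
qed

text \<open>The chart is \<open>z \<mapsto> (1 + Z) (\<Lambda> + D) (1 + Z)\<^sup>-\<^sup>1\<close> near \<open>\<Lambda> = diag d\<close>, where \<open>Z\<close> collects the entries of
  \<open>z\<close> at positions with different eigenvalues and \<open>D\<close> the other ones. Its derivative at \<open>0\<close>
  multiplies the entry of \<open>Z\<close> at \<open>(i, k)\<close> by \<open>d k - d i\<close> and leaves \<open>D\<close> unchanged, so it is
  injective; and on the subspace \<open>D = 0\<close> the values are conjugates of \<open>\<Lambda>\<close>.\<close>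

lemma class_dim_ge:
  fixes A :: "complex^'n^'n"
  assumes "eigenbasis A Q d"
  shows "card {(a, b). d a \<noteq> d b} \<le> class_dim A"
proof -
  define off :: "complex^('n \<times> 'n) \<Rightarrow> complex^'n^'n"
    where "off z = (\<chi> i k. if d i \<noteq> d k then z $ (i, k) else 0)" for z
  define dg :: "complex^('n \<times> 'n) \<Rightarrow> complex^'n^'n"
    where "dg z = (\<chi> i k. if d i \<noteq> d k then 0 else z $ (i, k))" for z
  define V where "V z = mat 1 + off z" for z
  define B where "B z = matrix_inv (V z)" for z
  define N where "N z = diag d + dg z" for z
  define U where "U = {z. invertible (V z)}"
  define W where "W = {z :: complex^('n \<times> 'n). \<forall>q. q \<notin> {(a, b). d a \<noteq> d b} \<longrightarrow> z $ q = 0}"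
  define F where "F z = flatten (V z ** N z ** B z)" for z
  define F' where "F' z h = flatten ((V z ** N z) ** (- (B z ** off h ** B z))
      + (V z ** dg h + off h ** N z) ** B z)" for z h
  have lin: "bounded_linear off" "bounded_linear dg"
    by (auto simp: off_def dg_def linear_conv_bounded_linear[symmetric] vec_eq_iff intro!: linearI)
  have linf: "bounded_linear (flatten :: complex^'n^'n \<Rightarrow> _)"
    by (auto simp: flatten_def linear_conv_bounded_linear[symmetric] vec_eq_iff intro!: linearI)
  have dV: "(V has_derivative off) (at z)" for z
    unfolding V_def using has_derivative_add[OF has_derivative_const bounded_linear_imp_has_derivative[OF lin(1)]] by simp
  have dN: "(N has_derivative dg) (at z)" for z
    unfolding N_def using has_derivative_add[OF has_derivative_const bounded_linear_imp_has_derivative[OF lin(2)]] by simp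
  have contV: "continuous_on S V" and contN: "continuous_on S N" for S
    using dV dN by (meson continuous_at_imp_continuous_on has_derivative_continuous)+
  have dB: "(B has_derivative (\<lambda>h. - (B z ** off h ** B z))) (at z)" if "z \<in> U" for z
    unfolding B_def
    by (rule has_derivative_compose[OF dV matrix_inv_has_derivative]) (use that in \<open>simp add: U_def\<close>)
  have contB: "continuous_on U B"
    unfolding B_def by (rule continuous_on_compose2[OF continuous_on_matrix_inv contV]) (auto simp: U_def)
  have V0: "V 0 = mat 1" "B 0 = mat 1" "N 0 = diag d"
  proof -
    show "V 0 = mat 1" by (simp add: V_def off_def vec_eq_iff)
    then show "B 0 = mat 1" by (simp add: B_def matrix_inv_unique)
    show "N 0 = diag d" by (simp add: N_def dg_def vec_eq_iff)
  qed
  have openU: "open U"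
  proof -
    have "U = V -` {A. invertible A}" by (auto simp: U_def)
    then show ?thesis using open_vimage[OF open_invertible contV] by simp
  qed
  have comm: "X ** mat c = mat c ** X" for X :: "complex^'n^'n" and c
    by (simp add: vec_eq_iff mat_eq_diag diag_mul_left diag_mul_right mult.commute)
  have comm': "X ** (mat c ** Y) = mat c ** (X ** Y)" for X Y :: "complex^'n^'n" and c
    by (metis comm matrix_mul_assoc)
  have "\<exists>U'. open U' \<and> 0 \<in> U' \<and> U' \<subseteq> U \<and>
      complex_submanifold (card {(a, b). d a \<noteq> d b}) (F ` (U' \<inter> W))"
  proof (rule complex_submanifold_image[OF openU])
    show "0 \<in> U" by (simp add: U_def V0 invertible_def exI[of _ "mat 1"])
    show "(F has_derivative F' z) (at z)" if "z \<in> U" for z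
      unfolding F_def F'_def
      by (rule bounded_linear.has_derivative[OF linf]
          matrix_mul_has_derivative[OF matrix_mul_has_derivative[OF dV dN] dB[OF that]])+
    show "F' z (c *s h) = c *s F' z h" for z c h
    proof -
      have "off (c *s h) = mat c ** off h" "dg (c *s h) = mat c ** dg h"
        by (simp_all add: off_def dg_def vec_eq_iff mat_eq_diag diag_mul_left)
      moreover have "flatten (mat c ** M) = c *s flatten M" for M
        by (simp add: flatten_def vec_eq_iff mat_eq_diag diag_mul_left)
      ultimately show ?thesis unfolding F'_def
        by (simp add: matrix_mul_add_left comm' matrix_mul_minus_right flip: matrix_mul_assoc)
          (simp flip: matrix_add_ldistrib matrix_mul_diff_right)
    qed
    show "continuous_on U (\<lambda>z. F' z h)" for h
      unfolding F'_def
      by (intro bounded_linear.continuous_on[OF linf] continuous_intros contV contN contB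
          continuous_on_subset[OF contV])
    show "h = 0" if "F' 0 h = 0" for h
    proof -
      define M where "M = diag d ** (- off h) + (dg h + off h ** diag d)"
      have "flatten M = 0" using that by (simp add: F'_def V0 M_def)
      then have "M $ i $ k = 0" for i k by (simp add: flatten_def vec_eq_iff)
      moreover have "M $ i $ k = (if d i \<noteq> d k then h $ (i, k) * (d k - d i) else h $ (i, k))" for i k
        by (simp add: M_def diag_mul_left diag_mul_right) (simp add: off_def dg_def algebra_simps)
      ultimately have "h $ (i, k) = 0" for i k
        by (metis eq_iff_diff_eq_0 mult_eq_0_iff)
      then show ?thesis by (simp add: vec_eq_iff)
    qed
    show "vec.subspace W" by (auto simp: W_def vec.subspace_def)
    show "vec.dim W = card {(a, b). d a \<noteq> d b}" unfolding W_def by (rule dim_substandard_cart)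
    show "0 \<in> W" by (simp add: W_def)
  qed
  then obtain U' where U': "0 \<in> U'" "U' \<subseteq> U"
    "complex_submanifold (card {(a, b). d a \<noteq> d b}) (F ` (U' \<inter> W))" by blast
  have "F z \<in> flatten ` conj_class (diag d)" if "z \<in> U" "z \<in> W" for z
  proof -
    have "dg z = 0" using that(2) by (auto simp: W_def dg_def vec_eq_iff)
    then have "V z ** N z ** B z \<in> conj_class (diag d)"
      using that(1) by (auto simp: conj_class_def N_def B_def U_def)
    then show ?thesis by (simp add: F_def)
  qed
  then have "F ` (U' \<inter> W) \<subseteq> flatten ` conj_class (diag d)" using U'(2) by blast
  moreover have "F ` (U' \<inter> W) \<noteq> {}" using U'(1) by (auto simp: W_def)
  moreover have "conj_class (diag d) = conj_class A"
  proof -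
    have "A \<in> conj_class (diag d)" using assms by (auto simp: eigenbasis_def intro: conj_classI)
    then show ?thesis by (rule conj_class_eq[symmetric])
  qed
  ultimately show ?thesis
    unfolding class_dim_def using complex_dimension_ge[OF U'(3)] by metis
qed


section \<open>Genericity and the sum or product condition\<close>

lemma one_to_Suc: "{1..p+1} = insert 1 {2..p+1}" for p :: nat
  by auto

text \<open>The remaining matrix is minus the sum of the others.\<close>

lemma zero_sum_common_eigenvector:
  fixes X :: "nat \<Rightarrow> complex^'n^'n"
  assumes "zero_sum p X" "j \<in> {1..p+1}"
    and ev: "\<And>i. i \<in> {1..p+1} - {j} \<Longrightarrow> X i *v v = c i *s v"
  shows "\<exists>c'. (\<forall>i\<in>{1..p+1}. X i *v v = c' i *s v) \<and> (\<Sum>i\<in>{1..p+1}. c' i) = 0"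
proof -
  let ?S = "{1..p+1} - {j}"
  \<comment> \<open>The eigenvalue at the index \<open>j\<close> is dictated by the sum condition.\<close>
  define c' where "c' = c(j := - (\<Sum>i\<in>?S. c i))"
  have vsum: "(\<Sum>i\<in>S. A i) *v v = (\<Sum>i\<in>S. A i *v v)" for S and A :: "nat \<Rightarrow> complex^'n^'n"
    by (induction S rule: infinite_finite_induct) (auto simp: matrix_vector_mult_add_rdistrib)
  have csum: "(\<Sum>i\<in>S. a i *s v) = (\<Sum>i\<in>S. a i) *s v" for S and a :: "nat \<Rightarrow> complex"
    by (induction S rule: infinite_finite_induct) (auto simp: vector_sadd_rdistrib)
  have "0 = (\<Sum>i\<in>{1..p+1}. X i) *v v" using assms(1) by (simp only: zero_sum_def matrix_vector_mult_0)
  also have "\<dots> = X j *v v + (\<Sum>i\<in>?S. X i *v v)"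
    unfolding vsum by (rule sum.remove) (use assms(2) in auto)
  also have "(\<Sum>i\<in>?S. X i *v v) = (\<Sum>i\<in>?S. c i) *s v"
    unfolding csum[symmetric] by (rule sum.cong[OF refl ev])
  finally have "X j *v v = c' j *s v"
    by (simp add: c'_def eq_neg_iff_add_eq_0 vec_eq_iff)
  then have "\<forall>i\<in>{1..p+1}. X i *v v = c' i *s v" using ev by (simp add: c'_def)
  moreover have "(\<Sum>i\<in>{1..p+1}. c' i) = c' j + (\<Sum>i\<in>?S. c' i)"
    by (rule sum.remove) (use assms(2) in auto)
  then have "(\<Sum>i\<in>{1..p+1}. c' i) = 0" by (simp add: c'_def)
  ultimately show ?thesis by blast
qed

text \<open>The products of the matrices to the left and to the right of the \<open>j\<close>-th one act on \<open>v\<close> by nonzero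
  scalars, so the condition on the product determines \<open>X j *v v\<close>.\<close>

lemma unit_product_common_eigenvector:
  fixes X :: "nat \<Rightarrow> complex^'n^'n"
  assumes up: "unit_product p X" and j: "j \<in> {1..p+1}" and v: "v \<noteq> 0"
    and inv: "\<And>i. i \<in> {1..p+1} \<Longrightarrow> invertible (X i)"
    and ev: "\<And>i. i \<in> {1..p+1} - {j} \<Longrightarrow> X i *v v = c i *s v"
  shows "\<exists>c'. (\<forall>i\<in>{1..p+1}. X i *v v = c' i *s v) \<and> (\<Prod>i\<in>{1..p+1}. c' i) = 1"
proof -
  define A where "A = tprod [1..<j] X"
  define B where "B = tprod [Suc j..<p+2] X"
  have split: "[1..<p+2] = [1..<j] @ j # [Suc j..<p+2]"
  proof -
    have "[1..<p+2] = [1..<j] @ [j..<p+2]" using j upt_add_eq_append[of 1 j "p + 2 - j"] by simp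
    also have "[j..<p+2] = j # [Suc j..<p+2]" using j by (intro upt_conv_Cons) auto
    finally show ?thesis .
  qed
  have AXB: "A ** (X j ** B) = mat 1"
    using up unfolding unit_product_tprod split by (simp add: tprod_append A_def B_def)
  obtain \<alpha> where \<alpha>: "A *v v = \<alpha> *s v"
  proof -
    have "A *v v = prod_list (map c [1..<j]) *s v"
      unfolding A_def by (rule tprod_eigenvector) (use ev j in auto)
    then show ?thesis by (rule that)
  qed
  obtain \<beta> where \<beta>: "B *v v = \<beta> *s v"
  proof -
    have "B *v v = prod_list (map c [Suc j..<p+2]) *s v"
      unfolding B_def by (rule tprod_eigenvector) (use ev in auto)
    then show ?thesis by (rule that)
  qed
  have iA: "invertible A" unfolding A_def by (rule tprod_invertible) (use inv j in auto)
  have "v = A *v (X j *v (B *v v))" by (simp add: matrix_vector_mul_assoc AXB)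
  also have "\<dots> = \<beta> *s (A *v (X j *v v))" by (simp add: \<beta> vector_scalar_commute)
  finally have 1: "v = \<beta> *s (A *v (X j *v v))" .
  then have \<beta>0: "\<beta> \<noteq> 0" using v by auto
  have \<alpha>0: "\<alpha> \<noteq> 0"
  proof
    assume "\<alpha> = 0"
    then have "A *v v = 0" by (simp add: \<alpha>)
    then show False using v vec_coords(2)[OF iA, of v] by simp
  qed
  have "A *v (X j *v v) = A *v ((1 / (\<alpha> * \<beta>)) *s v)"
  proof -
    have "A *v (X j *v v) = (1 / \<beta>) *s v"
      by (subst (2) 1) (simp add: vector_smult_assoc \<beta>0)
    then show ?thesis using \<alpha>0 by (simp add: vector_scalar_commute \<alpha> vector_smult_assoc)
  qed
  then have Xj: "X j *v v = (1 / (\<alpha> * \<beta>)) *s v" by (metis vec_coords(2)[OF iA])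
  define c' where "c' = c(j := 1 / (\<alpha> * \<beta>))"
  have all: "\<forall>i\<in>{1..p+1}. X i *v v = c' i *s v" using ev Xj by (simp add: c'_def)
  have "tprod [1..<p+2] X *v v = prod_list (map c' [1..<p+2]) *s v"
    by (rule tprod_eigenvector) (use all in auto)
  then have "v = prod_list (map c' [1..<p+2]) *s v" using up by (simp add: unit_product_tprod)
  moreover have "a = 1" if "v = a *s v" for a
    using that v by (metis vector_mul_rcancel vector_smult_lid)
  ultimately have "prod_list (map c' [1..<p+2]) = 1" by blast
  moreover have "prod_list (map c' [1..<p+2]) = (\<Prod>i\<in>{1..p+1}. c' i)"
  proof -
    have "set [1..<p+2] = {1..p+1}" by auto
    then show ?thesis by (metis distinct_upt prod.distinct_set_conv_list)
  qed
  ultimately show ?thesis using all by auto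
qed

lemma corner_linear_zero_sum: "corner_linear p (zero_sum p :: (nat \<Rightarrow> complex^'n^'n) \<Rightarrow> bool)"
  unfolding corner_linear_def
proof (intro allI impI)
  fix Y :: "nat \<Rightarrow> complex^'n^'n" and C
  assume Y: "zero_sum p Y \<and> (\<forall>j\<in>{1..p+1}. block_diag C (Y j))"
  show "\<exists>L R. (\<forall>j\<in>{2..p+1}. block_diag C (L j) \<and> block_diag C (R j)) \<and>
       (\<forall>T. (\<forall>j\<in>{2..p+1}. corner C (T j)) \<and> (\<Sum>j\<in>{2..p+1}. L j ** T j ** R j) = 0 \<longrightarrow>
          zero_sum p (\<lambda>j. if j \<in> {2..p+1} then Y j + T j else Y j))"
  proof (intro exI[of _ "\<lambda>_. mat 1"] conjI ballI allI impI block_diag_mat)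
    fix T :: "nat \<Rightarrow> complex^'n^'n"
    assume "(\<forall>j\<in>{2..p+1}. corner C (T j)) \<and> (\<Sum>j\<in>{2..p+1}. mat 1 ** T j ** mat 1) = 0"
    then have T: "(\<Sum>j\<in>{2..p+1}. T j) = 0" by (simp only: matrix_mul_lid matrix_mul_rid)
    have "(\<Sum>j\<in>{1..p+1}. if j \<in> {2..p+1} then Y j + T j else Y j)
        = Y 1 + (\<Sum>j\<in>{2..p+1}. Y j + T j)"
      unfolding one_to_Suc by (subst sum.insert) (auto intro!: sum.cong)
    also have "\<dots> = (\<Sum>j\<in>{1..p+1}. Y j)"
      unfolding one_to_Suc by (simp only: sum.distrib T) (subst sum.insert, auto)
    finally show "zero_sum p (\<lambda>j. if j \<in> {2..p+1} then Y j + T j else Y j)"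
      using Y unfolding zero_sum_def by simp
  qed
qed

lemma corner_linear_unit_product: "corner_linear p (unit_product p :: (nat \<Rightarrow> complex^'n^'n) \<Rightarrow> bool)"
  unfolding corner_linear_def
proof (intro allI impI)
  fix Y :: "nat \<Rightarrow> complex^'n^'n" and C
  assume Y: "unit_product p Y \<and> (\<forall>j\<in>{1..p+1}. block_diag C (Y j))"
  have set: "set [2..<p+2] = {2..p+1}" by auto
  have list: "[1..<p+2] = 1 # [2..<p+2]" using upt_conv_Cons[of 1 "p + 2"] by (simp add: numeral_2_eq_2)
  have "\<exists>L R. (\<forall>j\<in>{2..p+1}. block_diag C (L j) \<and> block_diag C (R j)) \<and>
    (\<forall>T. (\<forall>j\<in>{2..p+1}. corner C (T j)) \<longrightarrow>
       tprod [2..<p+2] (\<lambda>j. Y j + T j) = tprod [2..<p+2] Y + (\<Sum>j\<in>{2..p+1}. L j ** T j ** R j))"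
    by (rule tprod_corner_expansion[of "[2..<p+2]" C Y, unfolded set, OF distinct_upt]) (use Y in simp)
  then obtain L R where LR: "\<forall>j\<in>{2..p+1}. block_diag C (L j) \<and> block_diag C (R j)"
    "\<forall>T. (\<forall>j\<in>{2..p+1}. corner C (T j)) \<longrightarrow>
       tprod [2..<p+2] (\<lambda>j. Y j + T j) = tprod [2..<p+2] Y + (\<Sum>j\<in>{2..p+1}. L j ** T j ** R j)"
    by (elim exE conjE)
  show "\<exists>L R. (\<forall>j\<in>{2..p+1}. block_diag C (L j) \<and> block_diag C (R j)) \<and>
       (\<forall>T. (\<forall>j\<in>{2..p+1}. corner C (T j)) \<and> (\<Sum>j\<in>{2..p+1}. L j ** T j ** R j) = 0 \<longrightarrow>
          unit_product p (\<lambda>j. if j \<in> {2..p+1} then Y j + T j else Y j))"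
  proof (rule exI[of _ L], rule exI[of _ R], intro conjI LR(1) allI impI)
    fix T :: "nat \<Rightarrow> complex^'n^'n"
    assume T: "(\<forall>j\<in>{2..p+1}. corner C (T j)) \<and> (\<Sum>j\<in>{2..p+1}. L j ** T j ** R j) = 0"
    let ?Z = "\<lambda>j. if j \<in> {2..p+1} then Y j + T j else Y j"
    have "tprod [2..<p+2] ?Z = tprod [2..<p+2] (\<lambda>j. Y j + T j)"
      by (rule tprod_cong) auto
    also have "\<dots> = tprod [2..<p+2] Y" using LR(2)[THEN spec, of T] T by simp
    finally have "tprod [1..<p+2] ?Z = tprod [1..<p+2] Y" unfolding list by simp
    then show "unit_product p ?Z" using Y by (simp add: unit_product_tprod)
  qed
qed

lemma trivial_centralizer_conj:
  fixes Y :: "nat \<Rightarrow> complex^'n^'n" and Q :: "complex^'n^'n"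
  assumes Q: "invertible Q" and Y: "trivial_centralizer p Y"
  shows "trivial_centralizer p (\<lambda>j. Q ** Y j ** matrix_inv Q)"
  unfolding trivial_centralizer_def
proof (intro allI impI)
  fix B :: "complex^'n^'n"
  assume B: "\<forall>j\<in>{1..p+1}. B ** (Q ** Y j ** matrix_inv Q) = Q ** Y j ** matrix_inv Q ** B"
  let ?B = "matrix_inv Q ** B ** Q"
  have "?B ** Y j = Y j ** ?B" if "j \<in> {1..p+1}" for j
  proof -
    have "?B ** Y j = matrix_inv Q ** (B ** (Q ** Y j ** matrix_inv Q)) ** Q"
      by (simp add: matrix_mul_assoc matrix_inv_cancel Q)
    also have "\<dots> = matrix_inv Q ** (Q ** (Y j ** matrix_inv Q ** B)) ** Q"
      using B that by (simp add: matrix_mul_assoc)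
    also have "\<dots> = Y j ** ?B" by (simp add: matrix_inv_cancel Q) (simp add: matrix_mul_assoc)
    finally show ?thesis .
  qed
  then have "scalar_matrix ?B" using Y by (auto simp: trivial_centralizer_def)
  moreover have "B \<in> conj_class ?B"
    by (rule conj_classI[OF Q]) (simp add: matrix_mul_assoc matrix_inv_mult Q)
  ultimately show "scalar_matrix B" using scalar_matrix_conj by blast
qed

text \<open>The parts of the proof common to sums and products: the relation \<open>P\<close> enters only through the
  absence of common eigenvectors, its linearity in corner perturbations and its invariance under
  simultaneous conjugation.\<close>

lemma conditions_and_deformation:
  fixes X :: "nat \<Rightarrow> complex^'n^'n"
  assumes n2: "CARD('n) \<ge> 2"
    and dg: "\<And>j. j \<in> {1..p+1} \<Longrightarrow> diagonalizable (X j)"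
    and X1: "card (eigenvalues (X 1)) = CARD('n)"
    and notA: "\<not> case_A p X"
    and PX: "P X"
    and ncev: "\<And>Y j. P Y \<Longrightarrow> (\<And>i. i \<in> {1..p+1} \<Longrightarrow> Y i \<in> conj_class (X i)) \<Longrightarrow> j \<in> {1..p+1} \<Longrightarrow>
      no_common_eigenvector ({1..p+1} - {j}) Y"
    and lin: "corner_linear p P"
    and Pconj: "\<And>Q Y. invertible Q \<Longrightarrow> P Y \<Longrightarrow> P (\<lambda>j. Q ** Y j ** matrix_inv Q)"
  shows "cond_beta p X \<and> cond_alpha p X \<and> deformable (\<lambda>_. P) trivial_centralizer p X"
proof (intro conjI)
  have "\<forall>j. \<exists>Q d. j \<in> {1..p+1} \<longrightarrow> eigenbasis (X j) Q d"
    using dg diagonalizable_iff_eigenbasis by blast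
  then obtain Q f where eb: "\<And>j. j \<in> {1..p+1} \<Longrightarrow> eigenbasis (X j) (Q j) (f j)" by metis
  have bdU: "block_diag UNIV A" for A :: "complex^'n^'n" by (simp add: block_diag_nth)
  have beta: "CARD('n) \<le> (\<Sum>i\<in>{1..p+1} - {j}. card {a. f i a \<noteq> \<mu> i})" if "j \<in> {1..p+1}" for j \<mu>
  proof -
    have "no_common_eigenvector ({1..p+1} - {j}) X" using ncev[OF PX _ that] conj_class_refl by blast
    from no_common_eigenvector_count[OF _ this, of Q f UNIV \<mu>] show ?thesis
      using eb bdU by simp
  qed
  show "cond_beta p X"
    unfolding cond_beta_def
  proof
    fix j assume j: "j \<in> {1..p+1}"
    have "\<exists>c. min_rank (X i) = rank (X i - mat c)" for i
    proof -
      have "finite (range (\<lambda>c. rank (X i - mat c)))"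
        by (rule finite_subset[of _ "{..CARD('n)}"])
          (auto simp: row_rank_def_gen dim_subset_UNIV_cart_gen)
      then have "min_rank (X i) \<in> range (\<lambda>c. rank (X i - mat c))"
        unfolding min_rank_def by (rule Min_in) simp
      then show ?thesis by blast
    qed
    then obtain \<mu> where \<mu>: "\<And>i. min_rank (X i) = rank (X i - mat (\<mu> i))" by metis
    have "CARD('n) \<le> (\<Sum>i\<in>{1..p+1} - {j}. card {a. f i a \<noteq> \<mu> i})" by (rule beta[OF j])
    also have "\<dots> \<le> (\<Sum>i\<in>{1..p+1} - {j}. min_rank (X i))"
      unfolding \<mu> by (rule sum_mono) (use eb rank_eigenbasis_ge in blast)
    finally show "CARD('n) \<le> (\<Sum>i\<in>{1..p+1} - {j}. min_rank (X i))" .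
  qed
  have K: "{1..p+1} - {1} = {2..p+1}" by auto
  have eb2: "eigenbasis (X j) (Q j) (f j)" if "j \<in> {2..p+1}" for j using eb that by simp
  have inj: "inj (f 1)"
  proof (rule eq_card_imp_inj_on)
    show "card (range (f 1)) = card (UNIV :: 'n set)"
      using X1 eigenbasis_eigenvalues[OF eb[of 1]] by simp
  qed simp
  show "cond_alpha p X"
  proof -
    have "(CARD('n))\<^sup>2 + CARD('n) - 2 \<le> (\<Sum>j\<in>{2..p+1}. card {(a, b). f j a \<noteq> f j b})"
    proof (rule card_pairs_lower_bound)
      show "CARD('n) \<le> (\<Sum>j\<in>{2..p+1}. card {a. f j a \<noteq> \<mu> j})" for \<mu>
        using beta[of 1 \<mu>] by (simp only: K) simp
      show False if "4 \<le> CARD('n)" "even CARD('n)" "card {j \<in> {2..p+1}. card (range (f j)) \<noteq> 1} = 2"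
        "\<And>j. j \<in> {2..p+1} \<Longrightarrow> card (range (f j)) \<noteq> 1 \<Longrightarrow>
           card (range (f j)) = 2 \<and> (\<forall>x\<in>range (f j). 2 * mult_in UNIV (f j) x = CARD('n))"
        using notA case_A_I[of p X Q f, OF eb2 that] by simp
    qed (use n2 in auto)
    also have "\<dots> \<le> (\<Sum>j\<in>{2..p+1}. class_dim (X j))"
      by (rule sum_mono) (use class_dim_ge eb2 in blast)
    finally have rest: "(CARD('n))\<^sup>2 + CARD('n) - 2 \<le> (\<Sum>j\<in>{2..p+1}. class_dim (X j))" .
    have "card {a. f 1 a \<noteq> f 1 b} = CARD('n) - 1" for b
    proof -
      have "{a. f 1 a \<noteq> f 1 b} = UNIV - {b}" using inj by (auto dest: injD)
      then show ?thesis by simp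
    qed
    then have "card {(a, b). f 1 a \<noteq> f 1 b} = CARD('n) * (CARD('n) - 1)"
      using card_pairs_neq[of UNIV UNIV "f 1"] by simp
    then have first: "CARD('n) * (CARD('n) - 1) \<le> class_dim (X 1)"
      using class_dim_ge[OF eb[of 1]] by simp
    have "2 * (CARD('n))\<^sup>2 - 2 = CARD('n) * (CARD('n) - 1) + ((CARD('n))\<^sup>2 + CARD('n) - 2)"
    proof -
      obtain m where "CARD('n) = Suc (Suc m)" using n2 by (metis Suc_le_D numeral_2_eq_2 Suc_le_mono)
      then show ?thesis by (simp add: power2_eq_square)
    qed
    also have "\<dots> \<le> class_dim (X 1) + (\<Sum>j\<in>{2..p+1}. class_dim (X j))"
      by (rule add_mono[OF first rest])
    also have "\<dots> = (\<Sum>j\<in>{1..p+1}. class_dim (X j))"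
      unfolding one_to_Suc by (subst sum.insert) auto
    finally show ?thesis unfolding cond_alpha_def .
  qed
  show "deformable (\<lambda>_. P) trivial_centralizer p X"
    unfolding deformable_def
  proof (intro allI impI)
    fix \<epsilon> :: real assume \<epsilon>: "\<epsilon> > 0"
    \<comment> \<open>Conjugation to a tuple with diagonal first matrix, and back; it changes distances at most by
    the factor \<open>k\<close>.\<close>
    define q where "q = Q 1"
    have q: "invertible q" "X 1 ** q = q ** diag (f 1)"
      using eb[of 1] by (auto simp: eigenbasis_def q_def)
    define r where "r = matrix_inv q"
    have r: "invertible r" "matrix_inv r = q"
      using q by (auto simp: r_def invertible_matrix_inv matrix_inv_mult intro!: matrix_inv_unique)
    define X' where "X' j = r ** X j ** matrix_inv r" for j
    have conj: "X' j \<in> conj_class (X j)" for j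
      unfolding X'_def conj_class_def using r(1) by blast
    have "X' 1 = diag (f 1)"
      unfolding X'_def r(2) using q matrix_inv_cancel(2)[OF q(1)]
      by (simp add: r_def flip: matrix_mul_assoc)
    obtain k where k: "k > 0" "\<And>M. norm (q ** M ** r) \<le> norm M * k"
    proof -
      have "bounded_linear (\<lambda>M. q ** M ** r)"
        by (rule bounded_linear_compose[OF bounded_bilinear.bounded_linear_left[OF bounded_bilinear_matrix_mul]
              bounded_bilinear.bounded_linear_right[OF bounded_bilinear_matrix_mul]])
      then show ?thesis using bounded_linear.pos_bounded that by blast
    qed
    have "\<exists>Y. (\<forall>j\<in>{1..p+1}. Y j \<in> conj_class (X' j) \<and> dist (Y j) (X' j) < \<epsilon> / k) \<and> P Y \<and> trivial_centralizer p Y"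
    proof (rule deform_diagonal)
      show "X' 1 = diag (f 1)" by fact
      show "inj (f 1)" by (rule inj)
      show "diagonalizable (X' j)" if "j \<in> {2..p+1}" for j
        using dg[of j] that conj diagonalizable_conj by auto
      show "\<not> case_A p X'" using notA case_A_conj[of p X' X] conj by blast
      show "P X'" unfolding X'_def by (rule Pconj[OF r(1) PX])
      show "no_common_eigenvector {2..p+1} Y"
        if "P Y" "\<And>j. j \<in> {1..p+1} \<Longrightarrow> Y j \<in> conj_class (X' j)" for Y
      proof -
        have "Y j \<in> conj_class (X j)" if "j \<in> {1..p+1}" for j
          using conj_class_trans[OF conj] \<open>\<And>j. j \<in> {1..p+1} \<Longrightarrow> Y j \<in> conj_class (X' j)\<close>[OF that] by blast
        then show ?thesis using ncev[of Y 1] that(1) by (simp only: K) simp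
      qed
      show "\<epsilon> / k > 0" using \<epsilon> k by simp
    qed (rule lin)
    then obtain Y where Y: "\<And>j. j \<in> {1..p+1} \<Longrightarrow> Y j \<in> conj_class (X' j)"
      "\<And>j. j \<in> {1..p+1} \<Longrightarrow> dist (Y j) (X' j) < \<epsilon> / k" "P Y" "trivial_centralizer p Y" by blast
    define Z where "Z j = q ** Y j ** matrix_inv q" for j
    have "Z j \<in> conj_class (X j) \<and> dist (Z j) (X j) < \<epsilon>" if "j \<in> {1..p+1}" for j
    proof
      have "Z j \<in> conj_class (Y j)" unfolding Z_def conj_class_def using q(1) by blast
      then show "Z j \<in> conj_class (X j)"
        using conj_class_trans Y(1)[OF that] conj by blast
      have "X j = q ** X' j ** r"
        unfolding X'_def r(2) by (simp add: r_def matrix_mul_assoc matrix_inv_cancel matrix_inv_mult q(1))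
      then have "Z j - X j = q ** (Y j - X' j) ** r"
        by (simp add: Z_def r_def matrix_mul_diff_left matrix_mul_diff_right)
      then have "dist (Z j) (X j) \<le> dist (Y j) (X' j) * k" using k(2) by (simp add: dist_norm)
      also have "\<dots> < \<epsilon>" using Y(2)[OF that] k(1) by (simp add: pos_less_divide_eq)
      finally show "dist (Z j) (X j) < \<epsilon>" .
    qed
    moreover have "P Z" unfolding Z_def[abs_def] by (rule Pconj[OF q(1) Y(3)])
    moreover have "trivial_centralizer p Z"
      unfolding Z_def[abs_def] by (rule trivial_centralizer_conj[OF q(1) Y(4)])
    ultimately show "\<exists>Y. (\<forall>j\<in>{1..p+1}. Y j \<in> conj_class (X j) \<and> dist (Y j) (X j) < \<epsilon>) \<and> P Y \<and> trivial_centralizer p Y"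
      by blast
  qed
qed

text \<open>The eigenvalues of a common eigenvector form a choice of one entry from each of the given
  enumerations, which is what a relation with one eigenvalue per matrix consists of.\<close>

lemma common_eigenvalues_in_enum:
  fixes X Y :: "nat \<Rightarrow> complex^'n^'n"
  assumes dg: "\<And>j. j \<in> {1..p+1} \<Longrightarrow> diagonalizable (X j)"
    and enum: "\<And>j. j \<in> {1..p+1} \<Longrightarrow> eigenvalue_enum (X j) (l j)"
    and Y: "\<And>j. j \<in> {1..p+1} \<Longrightarrow> Y j \<in> conj_class (X j)"
    and v: "v \<noteq> 0" "\<And>j. j \<in> {1..p+1} \<Longrightarrow> Y j *v v = c j *s v"
  shows "\<exists>k. \<forall>j\<in>{1..p+1}. c j = l j (k j)"
proof -
  have "\<exists>k. c j = l j k" if j: "j \<in> {1..p+1}" for j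
  proof -
    have "c j \<in> eigenvalues (Y j)" using v(1) v(2)[OF j] by (auto simp: eigenvalues_def)
    then have "c j \<in> eigenvalues (X j)" using eigenvalues_conj[OF Y[OF j]] by simp
    then show ?thesis using eigenvalue_in_enum enum[OF j] dg[OF j] diagonalizable_iff_eigenbasis by blast
  qed
  then show ?thesis by metis
qed

theorem corollary25:
  fixes p :: nat
    and X :: "nat \<Rightarrow> complex^('n::{finite,linorder})^('n::{finite,linorder})"
    and l :: "nat \<Rightarrow> 'n \<Rightarrow> complex"
  assumes "\<forall>j\<in>{1..p+1}. diagonalizable (X j)"
    and "\<forall>j\<in>{1..p+1}. eigenvalue_enum (X j) (l j)"
    and "block_upper_triangular p X"
    and "card (eigenvalues (X 1)) = CARD('n)"
    and "\<not> case_A p X"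
  shows "(zero_sum p X \<and> additively_generic 2 p l \<longrightarrow>
            cond_beta p X \<and> cond_alpha p X \<and>
            deformable zero_sum trivial_centralizer p X) \<and>
         ((\<forall>j\<in>{1..p+1}. invertible (X j)) \<and> unit_product p X \<and>
            multiplicatively_generic 2 p l \<longrightarrow>
            cond_beta p X \<and> cond_alpha p X \<and>
            deformable unit_product trivial_centralizer p X)"
proof (intro conjI impI)
  have n2: "CARD('n) \<ge> 2"
  proof -
    obtain b :: "'n \<Rightarrow> nat" and i k where "b i \<noteq> b k"
      using assms(3) unfolding block_upper_triangular_def by blast
    then have "i \<noteq> k" by auto
    then have "card {i, k} \<le> CARD('n)" by (intro card_mono) auto
    then show ?thesis using \<open>i \<noteq> k\<close> by simp
  qed
  note dg = assms(1)[rule_format] and enum = assms(2)[rule_format]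
  {
    assume hyp: "zero_sum p X \<and> additively_generic 2 p l"
    have ncev: "no_common_eigenvector ({1..p+1} - {j}) Y"
      if Y: "zero_sum p Y" "\<And>i. i \<in> {1..p+1} \<Longrightarrow> Y i \<in> conj_class (X i)" and j: "j \<in> {1..p+1}" for Y j
      unfolding no_common_eigenvector_def
    proof (intro allI impI, rule ccontr)
      fix v assume "\<forall>i\<in>{1..p+1} - {j}. \<exists>c. Y i *v v = c *s v" and v: "v \<noteq> 0"
      then obtain c where "\<And>i. i \<in> {1..p+1} - {j} \<Longrightarrow> Y i *v v = c i *s v" by metis
      from zero_sum_common_eigenvector[OF Y(1) j this]
      obtain c' where c': "\<And>i. i \<in> {1..p+1} \<Longrightarrow> Y i *v v = c' i *s v" "(\<Sum>i\<in>{1..p+1}. c' i) = 0"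
        by blast
      obtain k where k: "\<forall>i\<in>{1..p+1}. c' i = l i (k i)"
        using common_eigenvalues_in_enum[of p X l Y v c', OF dg enum Y(2) v c'(1)] by blast
      have "(\<Sum>i\<in>{1..p+1}. \<Sum>x\<in>{k i}. l i x) = (\<Sum>i\<in>{1..p+1}. c' i)"
        by (rule sum.cong) (use k in auto)
      then have "additive_relation p l 1"
        unfolding additive_relation_def using n2 c'(2)
        by (intro conjI exI[of _ "\<lambda>i. {k i}"]) auto
      then show False using hyp n2 unfolding additively_generic_def by fastforce
    qed
    have Pc: "zero_sum p (\<lambda>j. Q ** Y j ** matrix_inv Q)" if "zero_sum p Y" 
      for Q :: "complex^('n::{finite,linorder})^('n::{finite,linorder})" and Y :: "nat \<Rightarrow> complex^('n::{finite,linorder})^('n::{finite,linorder})"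
    proof -
      have "(\<Sum>j\<in>{1..p+1}. Q ** Y j ** matrix_inv Q) = Q ** (\<Sum>j\<in>{1..p+1}. Y j) ** matrix_inv Q"
        by (simp only: matrix_mul_sum_left matrix_mul_sum_right)
      then show ?thesis using that by (simp only: zero_sum_def times0_left times0_right)
    qed
    have hyp1: "zero_sum p X" using hyp by simp
    have "cond_beta p X \<and> cond_alpha p X \<and> deformable (\<lambda>_. zero_sum p) trivial_centralizer p X"
    proof (rule conditions_and_deformation[OF n2 _ assms(4,5) hyp1 _ corner_linear_zero_sum])
      show "diagonalizable (X j)" if "j \<in> {1..p+1}" for j using that by (rule dg)
      show "no_common_eigenvector ({1..p+1} - {j}) Y"
        if "zero_sum p Y" "\<And>i. i \<in> {1..p+1} \<Longrightarrow> Y i \<in> conj_class (X i)" "j \<in> {1..p+1}" for Y j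
        by (rule ncev) (use that in auto)
      show "zero_sum p (\<lambda>j. Q ** Y j ** matrix_inv Q)" if "invertible Q" "zero_sum p Y"
        for Q :: "complex^('n::{finite,linorder})^('n::{finite,linorder})" and Y
        by (rule Pc[OF that(2)])
    qed
    then show "cond_beta p X" "cond_alpha p X" "deformable zero_sum trivial_centralizer p X"
      by (simp_all add: deformable_def)
  next
    assume hyp: "(\<forall>j\<in>{1..p+1}. invertible (X j)) \<and> unit_product p X \<and> multiplicatively_generic 2 p l"
    have inv: "invertible A" if "A \<in> conj_class (X i)" "i \<in> {1..p+1}" for A i
    proof -
      have "invertible (X i)" using hyp that(2) by blast
      then show ?thesis using that(1) unfolding conj_class_def
        by (auto intro!: invertible_mult invertible_matrix_inv)
    qed
    have ncev: "no_common_eigenvector ({1..p+1} - {j}) Y"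
      if Y: "unit_product p Y" "\<And>i. i \<in> {1..p+1} \<Longrightarrow> Y i \<in> conj_class (X i)" and j: "j \<in> {1..p+1}" for Y j
      unfolding no_common_eigenvector_def
    proof (intro allI impI, rule ccontr)
      fix v assume "\<forall>i\<in>{1..p+1} - {j}. \<exists>c. Y i *v v = c *s v" and v: "v \<noteq> 0"
      then obtain c where "\<And>i. i \<in> {1..p+1} - {j} \<Longrightarrow> Y i *v v = c i *s v" by metis
      from unit_product_common_eigenvector[OF Y(1) j v inv[OF Y(2)] this]
      obtain c' where c': "\<And>i. i \<in> {1..p+1} \<Longrightarrow> Y i *v v = c' i *s v" "(\<Prod>i\<in>{1..p+1}. c' i) = 1"
        by blast
      obtain k where k: "\<forall>i\<in>{1..p+1}. c' i = l i (k i)"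
        using common_eigenvalues_in_enum[of p X l Y v c', OF dg enum Y(2) v c'(1)] by blast
      have "(\<Prod>i\<in>{1..p+1}. \<Prod>x\<in>{k i}. l i x) = (\<Prod>i\<in>{1..p+1}. c' i)"
        by (rule prod.cong) (use k in auto)
      then have "multiplicative_relation p l 1"
        unfolding multiplicative_relation_def using n2 c'(2)
        by (intro conjI exI[of _ "\<lambda>i. {k i}"]) auto
      then show False using hyp n2 unfolding multiplicatively_generic_def by fastforce
    qed
    have Pc: "unit_product p (\<lambda>j. Q ** Y j ** matrix_inv Q)"
      if "invertible Q" "unit_product p Y" 
      for Q :: "complex^('n::{finite,linorder})^('n::{finite,linorder})" and Y :: "nat \<Rightarrow> complex^('n::{finite,linorder})^('n::{finite,linorder})"
      using that by (simp add: unit_product_tprod tprod_conj matrix_inv_mult del: upt_Suc)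
    have hyp1: "unit_product p X" using hyp by simp
    have "cond_beta p X \<and> cond_alpha p X \<and> deformable (\<lambda>_. unit_product p) trivial_centralizer p X"
    proof (rule conditions_and_deformation[OF n2 _ assms(4,5) hyp1 _ corner_linear_unit_product])
      show "diagonalizable (X j)" if "j \<in> {1..p+1}" for j using that by (rule dg)
      show "no_common_eigenvector ({1..p+1} - {j}) Y"
        if "unit_product p Y" "\<And>i. i \<in> {1..p+1} \<Longrightarrow> Y i \<in> conj_class (X i)" "j \<in> {1..p+1}" for Y j
        by (rule ncev) (use that in auto)
      show "unit_product p (\<lambda>j. Q ** Y j ** matrix_inv Q)" if "invertible Q" "unit_product p Y"
        for Q :: "complex^('n::{finite,linorder})^('n::{finite,linorder})" and Y
        by (rule Pc[OF that])
    qed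
    then show "cond_beta p X" "cond_alpha p X" "deformable unit_product trivial_centralizer p X"
      by (simp_all add: deformable_def)
  }
qed

end
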